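(* For every integer $n \ge 1$, $\mu(ST_3^n) = 3^{n-1} + 3$.
   Context: Sierpiński triangle graphs are defined recursively: $ST_3^0 = K_3$, whose three vertices are its extreme vertices, called top, left and right. For $n \ge 0$, $ST_3^{n+1}$ is obtained from three disjoint copies $T, L, R$ of $ST_3^n$ by identifying the left extreme vertex of $T$ with the top extreme vertex of $L$, the right extreme vertex of $T$ with the top extreme vertex of $R$, and the right extreme vertex of $L$ with the left extreme vertex of $R$; the extreme vertices of $ST_3^{n+1}$ are the top vertex of $T$, the left vertex of $L$ and the right vertex of $R$. For a graph $G$ and $M \subseteq V(G)$, vertices $u,v$ are $M$-visible if there is a shortest $u,v$-path in $G$ containing no vertex of $M \setminus \{u,v\}$. $M$ is a mutual-visibility set if every two vertices of $M$ are $M$-visible. The mutual-visibility number $\mu(G)$ is the largest cardinality of a mutual-visibility set of $G$. *)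

theory Defs
  imports "Graph_Theory.Graph_Theory"
begin

section \<open>Sierpinski triangle graphs\<close>

text \<open>
  Following \<^theory>\<open>Graph_Theory.Digraph\<close>, an undirected simple graph is a symmetric, loop-free
  digraph without parallel arcs (locale \<^locale>\<open>pair_graph\<close>).
  The three copies of a graph are labelled by the same three names as its extreme vertices, and
  the copy of vertex \<open>w\<close> in copy \<open>c\<close> is the word \<open>c # w\<close>; so the copies are disjoint.
\<close>

datatype corner = Top | Left | Right

primrec extreme :: "nat \<Rightarrow> corner \<Rightarrow> corner list" where
  "extreme 0 c = [c]"
| "extreme (Suc n) c = c # extreme n c"

text \<open>
  \<open>glue n\<close> is the quotient map that performs the three identifications on the disjoint union of
  the copies, sending each vertex to a representative of its class (see \<open>glue_eq_iff\<close> below).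
  The vertices \<open>c # extreme n c\<close> are not affected, so they are the extreme vertices of the result.
\<close>

definition glue :: "nat \<Rightarrow> corner list \<Rightarrow> corner list" where
  "glue n x =
    (if x = Left # extreme n Top then Top # extreme n Left
     else if x = Right # extreme n Top then Top # extreme n Right
     else if x = Right # extreme n Left then Left # extreme n Right
     else x)"

primrec ST3 :: "nat \<Rightarrow> corner list pair_pre_digraph" where
  "ST3 0 =
    \<lparr> pverts = {[Top], [Left], [Right]},
      parcs = {(u, v). u \<in> {[Top], [Left], [Right]} \<and> v \<in> {[Top], [Left], [Right]} \<and> u \<noteq> v} \<rparr>"
| "ST3 (Suc n) =
    \<lparr> pverts = {glue n (c # u) | c u. u \<in> pverts (ST3 n)},
      parcs = {(glue n (c # u), glue n (c # v)) | c u v. (u, v) \<in> parcs (ST3 n)} \<rparr>"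

lemma extreme_inject [simp]: "extreme n i = extreme n j \<longleftrightarrow> i = j"
  by (cases n) auto

lemma glue_eq_iff:
  "glue n x = glue n y \<longleftrightarrow>
    x = y \<or> (\<exists>i j. x = i # extreme n j \<and> y = j # extreme n i)"
proof
  assume "glue n x = glue n y"
  then show "x = y \<or> (\<exists>i j. x = i # extreme n j \<and> y = j # extreme n i)"
    by (auto simp: glue_def split: if_splits)
next
  assume "x = y \<or> (\<exists>i j. x = i # extreme n j \<and> y = j # extreme n i)"
  then show "glue n x = glue n y"
  proof
    assume "\<exists>i j. x = i # extreme n j \<and> y = j # extreme n i"
    then obtain i j where "x = i # extreme n j" "y = j # extreme n i" by blast
    then show ?thesis by (cases i; cases j) (auto simp: glue_def)
  qed simp
qed

lemma glue_extreme: "glue n (extreme (Suc n) c) = extreme (Suc n) c"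
  by (cases c) (auto simp: glue_def)

lemma extreme_in_ST3: "extreme n c \<in> pverts (ST3 n)"
proof (induction n)
  case 0
  show ?case by (cases c) auto
next
  case (Suc n)
  have "extreme (Suc n) c = glue n (c # extreme n c)"
    using glue_extreme[of n c] by simp
  with Suc show ?case by auto
qed

lemma ST3_0_complete: "K\<^bsub>3\<^esub> (with_proj (ST3 0))"
  by (auto simp: complete_digraph_pair_def)

lemma finite_UNIV_corner: "finite (UNIV :: corner set)"
proof -
  have "(UNIV :: corner set) = {Top, Left, Right}" by (auto intro: corner.exhaust)
  then show ?thesis by (metis finite.simps)
qed

lemma pair_graph_ST3: "pair_graph (ST3 n)"
proof (induction n)
  case 0
  show ?case using ST3_0_complete by (rule pair_graphI_complete)
next
  case (Suc n)
  interpret pair_graph "ST3 n" by (rule Suc)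
  have V: "pverts (ST3 (Suc n)) = (\<lambda>(c, u). glue n (c # u)) ` (UNIV \<times> pverts (ST3 n))"
    by auto
  have fin: "finite (pverts (ST3 (Suc n)))"
    unfolding V using finite_UNIV_corner pair_finite_verts by blast
  have sub: "parcs (ST3 (Suc n)) \<subseteq> pverts (ST3 (Suc n)) \<times> pverts (ST3 (Suc n))"
    by (auto dest: in_arcsD1 in_arcsD2)
  have sym: "(v, u) \<in> parcs (ST3 n)" if "(u, v) \<in> parcs (ST3 n)" for u v
    using pair_sym_arcs that by (auto simp: symmetric_def elim: symE)
  have ne: "u \<noteq> v" if "(u, v) \<in> parcs (ST3 n)" for u v
    using pair_no_loops[OF that] by simp
  show ?case
  proof unfold_locales
    show "finite (parcs (ST3 (Suc n)))"
      using fin sub by (meson finite_SigmaI finite_subset)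
  next
    fix e assume "e \<in> parcs (ST3 (Suc n))"
    then show "fst e \<noteq> snd e"
      by (auto simp: glue_eq_iff dest: ne)
  next
    fix e assume "e \<in> parcs (ST3 (Suc n))"
    then have "e \<in> pverts (ST3 (Suc n)) \<times> pverts (ST3 (Suc n))" using sub by blast
    then show "fst e \<in> pverts (ST3 (Suc n))" "snd e \<in> pverts (ST3 (Suc n))"
      by (simp_all only: mem_Times_iff)
  next
    show "finite (pverts (ST3 (Suc n)))" by (rule fin)
  next
    show "symmetric (with_proj (ST3 (Suc n)))"
      by (auto simp: symmetric_def intro!: symI dest: sym)
  qed
qed


section \<open>Mutual visibility\<close>

definition shortest_vpath :: "('a, 'b) pre_digraph \<Rightarrow> 'a \<Rightarrow> 'a vwalk \<Rightarrow> 'a \<Rightarrow> bool" where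
  "shortest_vpath G u p v \<longleftrightarrow>
    vpath p G \<and> hd p = u \<and> last p = v \<and>
    (\<forall>q. vpath q G \<and> hd q = u \<and> last q = v \<longrightarrow> vwalk_length p \<le> vwalk_length q)"

definition visible :: "('a, 'b) pre_digraph \<Rightarrow> 'a set \<Rightarrow> 'a \<Rightarrow> 'a \<Rightarrow> bool" where
  "visible G M u v \<longleftrightarrow> (\<exists>p. shortest_vpath G u p v \<and> set p \<inter> (M - {u, v}) = {})"

definition mutual_visibility_set :: "('a, 'b) pre_digraph \<Rightarrow> 'a set \<Rightarrow> bool" where
  "mutual_visibility_set G M \<longleftrightarrow>
    M \<subseteq> verts G \<and> (\<forall>u\<in>M. \<forall>v\<in>M. u \<noteq> v \<longrightarrow> visible G M u v)"

definition mutual_visibility_number :: "('a, 'b) pre_digraph \<Rightarrow> nat" where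
  "mutual_visibility_number G = Max {card M | M. mutual_visibility_set G M}"

text \<open>For finite graphs the maximum above is taken over a finite, nonempty set.\<close>

lemma (in fin_digraph) mutual_visibility_cards:
  "finite {card M | M. mutual_visibility_set G M}"
  "{card M | M. mutual_visibility_set G M} \<noteq> {}"
proof -
  have "{card M | M. mutual_visibility_set G M} \<subseteq> card ` Pow (verts G)"
    by (auto simp: mutual_visibility_set_def)
  then show "finite {card M | M. mutual_visibility_set G M}"
    by (rule finite_subset) simp
  have "mutual_visibility_set G {}" by (simp add: mutual_visibility_set_def)
  then show "{card M | M. mutual_visibility_set G M} \<noteq> {}" by blast
qed

end

theory Submission
  imports Defs
begin

text \<open>
  A copy of \<open>ST\<^sub>n\<close> inside \<open>ST\<^sub>n\<^sub>+\<^sub>1\<close> is geodesically convex, and a geodesic between two copies uses either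
  their common vertex (the direct route) or a whole side of the third copy (the long route).
  Hence the part of a mutual-visibility set \<open>M\<close> lying in one copy normally sees both inner corners of
  that copy. Counting therefore needs bounds for sets \<open>M\<close> that avoid and see a set \<open>C\<close> of corners. With
  \<open>A = 3\<^sup>n\<^sup>-\<^sup>1\<close> (and \<open>A = 0\<close> for \<open>n = 0\<close>), three bounds are proved by simultaneous induction on \<open>n\<close>:
  \<^item> \<open>|M| \<le> A + 3 - |C|\<close> if \<open>|C| \<le> 2\<close>;
  \<^item> \<open>|M| \<le> A\<close> if \<open>C\<close> consists of all three corners and the two sides at one of them are free of \<open>M\<close>;
  \<^item> \<open>|M| \<le> A\<close> if \<open>M\<close> sees a corner and lies strictly closer to it than to another corner.

  The second bound saves one vertex for every copy whose own corner is in \<open>C\<close>: the other two parts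
  see this corner along the two sides ending there. The third one pays for long routes: if some
  vertex of copy \<open>j\<close> does not see copy \<open>i\<close> directly, then all of \<open>M\<close> in copy \<open>i\<close> is closer to the
  third copy \<open>k\<close> than to \<open>j\<close>.

  Conversely, if \<open>J\<close> together with the three corners is a mutual-visibility set of \<open>ST\<^sub>n\<close>, then so
  are the three copies of \<open>J\<close> together with the corners of \<open>ST\<^sub>n\<^sub>+\<^sub>1\<close>; this starts at \<open>n = 2\<close> with
  the three vertices that are not on a side.
\<close>

section \<open>Geodesics avoiding a set\<close>

text \<open>Where no walk exists the \<open>LEAST\<close> is an unspecified number, so most facts
  below assume reachability or a given walk.\<close>

definition rdist :: "('a \<times> 'a) set \<Rightarrow> 'a \<Rightarrow> 'a \<Rightarrow> nat" where
  "rdist R u v = (LEAST k. (u, v) \<in> R ^^ k)"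

text \<open>
  \<open>clear_geodesic R M v u\<close>: some geodesic from \<open>u\<close> to the fixed target \<open>v\<close> has no interior vertex in \<open>M\<close>.
\<close>

inductive clear_geodesic :: "('a \<times> 'a) set \<Rightarrow> 'a set \<Rightarrow> 'a \<Rightarrow> 'a \<Rightarrow> bool"
  for R :: "('a \<times> 'a) set" and M :: "'a set" and v :: 'a where
  endpoint: "clear_geodesic R M v v"
| step: "(u, w) \<in> R \<Longrightarrow> rdist R u v = Suc (rdist R w v) \<Longrightarrow> w \<notin> M \<or> w = v \<Longrightarrow>
    clear_geodesic R M v w \<Longrightarrow> clear_geodesic R M v u"

lemma rdist_le: "(u, v) \<in> R ^^ k \<Longrightarrow> rdist R u v \<le> k"
  by (simp add: rdist_def Least_le)

lemma rdist_walk: "(u, v) \<in> R\<^sup>* \<Longrightarrow> (u, v) \<in> R ^^ rdist R u v"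
  unfolding rdist_def by (rule LeastI_ex) (simp add: rtrancl_is_UN_relpow)

lemma rdist_self [simp]: "rdist R u u = 0"
  using rdist_le[of u u 0 R] by simp

lemma rdist_eq_0_iff: "(u, v) \<in> R\<^sup>* \<Longrightarrow> rdist R u v = 0 \<longleftrightarrow> u = v"
  using rdist_walk[of u v R] by auto

lemma rdist_triangle:
  assumes "(u, v) \<in> R\<^sup>*" "(v, w) \<in> R\<^sup>*"
  shows "rdist R u w \<le> rdist R u v + rdist R v w"
  using assms[THEN rdist_walk] by (intro rdist_le) (auto simp: relpow_add)

lemma rdist_sym:
  assumes "sym R"
  shows "rdist R u v = rdist R v u"
proof -
  have "(v, u) \<in> R ^^ k" if "(u, v) \<in> R ^^ k" for k u v
    using that
  proof (induction k arbitrary: v)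
    case (Suc k)
    then obtain w where "(u, w) \<in> R ^^ k" "(w, v) \<in> R" by auto
    then have "(v, w) \<in> R" "(w, u) \<in> R ^^ k" using Suc assms by (auto dest: symD)
    then show ?case by (rule relpow_Suc_I2)
  qed simp
  then have "(u, v) \<in> R ^^ k \<longleftrightarrow> (v, u) \<in> R ^^ k" for k by blast
  then show ?thesis by (simp add: rdist_def)
qed

lemma rdist_step:
  assumes "(u, w) \<in> R" "(w, v) \<in> R\<^sup>*"
  shows "rdist R u v \<le> Suc (rdist R w v)"
  using assms(1) rdist_walk[OF assms(2)] by (intro rdist_le) (rule relpow_Suc_I2)

lemma clear_geodesic_reachable: "clear_geodesic R M v u \<Longrightarrow> (u, v) \<in> R\<^sup>*"
  by (induction rule: clear_geodesic.induct) auto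

lemma clear_geodesic_antimono:
  "clear_geodesic R M v u \<Longrightarrow> M' \<subseteq> M \<Longrightarrow> clear_geodesic R M' v u"
  by (induction rule: clear_geodesic.induct) (auto intro: clear_geodesic.intros)

text \<open>Additivity of the distances makes the concatenation a geodesic; by the triangle
  inequality it passes on to every later vertex of the first leg, which drives the induction. The
  junction \<open>w\<close> may lie in \<open>M\<close> only as an end of the whole path.\<close>

lemma clear_geodesic_append:
  assumes "clear_geodesic R M w u" "clear_geodesic R M v w" "w \<notin> M \<or> w = u \<or> w = v"
    and "rdist R u v = rdist R u w + rdist R w v"
  shows "clear_geodesic R M v u"
  using assms
proof (induction rule: clear_geodesic.induct)
  case (step u z)
  have r: "(z, w) \<in> R\<^sup>*" "(w, v) \<in> R\<^sup>*" "(z, v) \<in> R\<^sup>*"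
    using step.hyps(4) step.prems(1) clear_geodesic_reachable by (metis, metis, metis rtrancl_trans)
  have "rdist R u v \<le> Suc (rdist R z v)" "rdist R z v \<le> rdist R z w + rdist R w v"
    using step.hyps(1) r by (auto intro: rdist_step rdist_triangle)
  then have e: "rdist R z v = rdist R z w + rdist R w v" "rdist R u v = Suc (rdist R z v)"
    using step by auto
  show ?case
  proof (cases "w = u")
    case True
    then show ?thesis using step.prems(1) by simp
  next
    case False
    then have w: "w \<notin> M \<or> w = v" using step.prems by auto
    show ?thesis
      using step.hyps(1,3) step.prems e w step.IH
      by (intro clear_geodesic.step[of u z]) auto
  qed
qed simp

lemma clear_geodesic_edge:
  assumes "(u, v) \<in> R" "u \<noteq> v"
  shows "clear_geodesic R M v u"
proof (rule clear_geodesic.step[OF assms(1)])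
  have "rdist R u v \<noteq> 0" using assms rdist_eq_0_iff[of u v R] by auto
  moreover have "rdist R u v \<le> 1" using assms(1) by (intro rdist_le) auto
  ultimately show "rdist R u v = Suc (rdist R v v)" by simp
qed (auto intro: clear_geodesic.endpoint)

text \<open>Clear geodesics grow at their start towards a fixed target, so reversal needs an
  induction: the reversed first edge is appended at the far end.\<close>

lemma clear_geodesic_sym:
  assumes "clear_geodesic R M v u" "sym R"
  shows "clear_geodesic R M u v"
  using assms(1)
proof (induction rule: clear_geodesic.induct)
  case (step u w)
  show ?case
  proof (cases "u = w")
    case False
    then have wu: "clear_geodesic R M u w"
      using step.hyps(1) assms(2) by (intro clear_geodesic_edge) (auto dest: symD)
    have "rdist R v u = Suc (rdist R v w)"
      using step.hyps(2) rdist_sym[OF assms(2)] by metis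
    moreover have "rdist R w u = 1"
    proof -
      have "rdist R w u \<le> 1"
        using step.hyps(1) assms(2) by (intro rdist_le) (auto dest: symD)
      moreover have "rdist R w u \<noteq> 0"
        using False rdist_eq_0_iff[of w u R] clear_geodesic_reachable[OF wu] by auto
      ultimately show ?thesis by simp
    qed
    ultimately show ?thesis
      using step wu by (intro clear_geodesic_append[of R M w v u]) auto
  qed (use step in simp)
qed (rule clear_geodesic.endpoint)

section \<open>Clear geodesics and paths of the graph\<close>

lemma vwalk_relpow:
  assumes "vwalk p (with_proj G)"
  shows "(hd p, last p) \<in> parcs G ^^ (length p - 1)"
  using assms
proof (induction p rule: vwalk_induct)
  case (Cons u v es)
  then show ?case using relpow_Suc_I2[of u v "parcs G" "last (v # es)" "length es"]
    by auto
qed simp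

text \<open>The last conjunct strengthens the induction: distances to \<open>v\<close> on the tail
  lie strictly below that of \<open>u\<close>, so \<open>u\<close> does not recur and the walk is a
  path.\<close>

lemma clear_geodesic_imp_vpath:
  assumes "clear_geodesic (parcs G) M v u" "v \<in> pverts G" "pair_wf_digraph G"
  shows "\<exists>p. vpath p (with_proj G) \<and> hd p = u \<and> last p = v \<and> length p = Suc (rdist (parcs G) u v) \<and>
    set (tl p) \<inter> (M - {v}) = {} \<and> (\<forall>w\<in>set (tl p). rdist (parcs G) w v < rdist (parcs G) u v)"
  using assms(1)
proof (induction rule: clear_geodesic.induct)
  case endpoint
  show ?case using assms(2) by (intro exI[of _ "[v]"]) (auto intro: vpath_self)
next
  case (step u w)
  then obtain p where p: "vpath p (with_proj G)" "hd p = w" "last p = v"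
    "length p = Suc (rdist (parcs G) w v)" "set (tl p) \<inter> (M - {v}) = {}"
    "\<forall>w'\<in>set (tl p). rdist (parcs G) w' v < rdist (parcs G) w v" by blast
  have ne: "p \<noteq> []" using p(4) by auto
  have sp: "set p = insert w (set (tl p))" using ne p(2) by (cases p) auto
  have lt: "\<forall>w'\<in>set p. rdist (parcs G) w' v < rdist (parcs G) u v"
    using step.hyps(2) p(6) unfolding sp by auto
  interpret pair_wf_digraph G by (rule assms(3))
  have "vwalk (u # p) (with_proj G)"
    using p(1,2) step.hyps(1) by (intro vwalk_wf_digraph_consI) auto
  then have "vpath (u # p) (with_proj G)" using p(1) lt unfolding vpath_def by auto
  moreover have "set p \<inter> (M - {v}) = {}"
    using step.hyps(3) p(5) unfolding sp by blast
  ultimately show ?case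
    using ne p(3,4) step.hyps(2) lt by (intro exI[of _ "u # p"]) simp
qed

text \<open>Removing the first vertex of a walk of minimal length leaves one of minimal length: the
  remaining length bounds the distance from above, and the distance drops by at most one along the
  removed edge.\<close>

lemma vwalk_imp_clear_geodesic:
  assumes "vwalk p (with_proj G)" "set (tl p) \<inter> (M - {last p}) = {}"
    "length p = Suc (rdist (parcs G) (hd p) (last p))"
  shows "clear_geodesic (parcs G) M (last p) (hd p)"
  using assms
proof (induction p rule: list.induct)
  case (Cons u q)
  show ?case
  proof (cases "q = []")
    case True
    then show ?thesis by (auto intro: clear_geodesic.endpoint)
  next
    case False
    let ?z = "last q" and ?v = "hd q"
    have q: "(u, ?v) \<in> parcs G" "vwalk q (with_proj G)"
      using Cons.prems(1) False by (auto elim!: vwalk_consE)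
    note w = vwalk_relpow[OF q(2)]
    have "rdist (parcs G) ?v ?z \<le> length q - 1" using rdist_le[OF w] .
    moreover have "rdist (parcs G) u ?z \<le> Suc (rdist (parcs G) ?v ?z)"
      using q(1) w relpow_imp_rtrancl by (intro rdist_step)
    ultimately have e: "rdist (parcs G) u ?z = Suc (rdist (parcs G) ?v ?z)"
      "length q = Suc (rdist (parcs G) ?v ?z)"
      using Cons.prems(3) False length_greater_0_conv[of q] by (simp_all del: length_greater_0_conv)
    have v: "?v \<notin> M \<or> ?v = ?z" "set (tl q) \<inter> (M - {?z}) = {}"
      using Cons.prems(2) False list.set_sel[of q] by (cases q; auto)+
    then have "clear_geodesic (parcs G) M ?z ?v"
      using Cons.IH q(2) e by blast
    then show ?thesis
      using q e v False by (auto intro: clear_geodesic.step[of u ?v])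
  qed
qed auto

section \<open>Distances in Sierpinski triangle graphs\<close>

abbreviation dst :: "nat \<Rightarrow> corner list \<Rightarrow> corner list \<Rightarrow> nat" where
  "dst n \<equiv> rdist (parcs (ST3 n))"

abbreviation sees :: "nat \<Rightarrow> corner list set \<Rightarrow> corner list \<Rightarrow> corner list \<Rightarrow> bool" where
  "sees n M u v \<equiv> clear_geodesic (parcs (ST3 n)) M v u"

section \<open>Embedding the three copies\<close>

definition emb :: "nat \<Rightarrow> corner \<Rightarrow> corner list \<Rightarrow> corner list" where
  "emb n i u = glue n (i # u)"

lemma emb_inject [simp]: "emb n i u = emb n i v \<longleftrightarrow> u = v"
  by (auto simp: emb_def glue_eq_iff)

lemma emb_eq_iff: "i \<noteq> j \<Longrightarrow> emb n i u = emb n j v \<longleftrightarrow> u = extreme n j \<and> v = extreme n i"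
  by (auto simp: emb_def glue_eq_iff)

lemma emb_extreme_commute: "emb n i (extreme n j) = emb n j (extreme n i)"
  by (cases "i = j") (auto simp: emb_eq_iff)

lemma extreme_Suc_emb: "extreme (Suc n) c = emb n c (extreme n c)"
  using glue_extreme[of n c] by (simp add: emb_def)

lemma pverts_Suc: "pverts (ST3 (Suc n)) = (\<Union>i. emb n i ` pverts (ST3 n))"
  by (auto simp: emb_def)

lemma parcs_Suc:
  "(x, y) \<in> parcs (ST3 (Suc n)) \<longleftrightarrow> (\<exists>i u v. (u, v) \<in> parcs (ST3 n) \<and> x = emb n i u \<and> y = emb n i v)"
  by (auto simp: emb_def)

declare ST3.simps [simp del] extreme.simps [simp del]

lemma emb_in_pverts: "u \<in> pverts (ST3 n) \<Longrightarrow> emb n i u \<in> pverts (ST3 (Suc n))"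
  by (auto simp: pverts_Suc)

lemma emb_in_pverts_iff: "emb n i u \<in> pverts (ST3 (Suc n)) \<longleftrightarrow> u \<in> pverts (ST3 n)"
proof
  assume "emb n i u \<in> pverts (ST3 (Suc n))"
  then obtain j v where v: "emb n i u = emb n j v" "v \<in> pverts (ST3 n)"
    by (auto simp: pverts_Suc)
  then show "u \<in> pverts (ST3 n)"
    by (cases "i = j") (auto simp: emb_eq_iff extreme_in_ST3)
qed (rule emb_in_pverts)

lemma sym_parcs: "sym (parcs (ST3 n))"
proof -
  interpret pair_graph "ST3 n" by (rule pair_graph_ST3)
  show ?thesis using pair_sym_arcs by (auto simp: symmetric_def)
qed

lemma parcs_in_pverts: "(u, v) \<in> parcs (ST3 n) \<Longrightarrow> u \<in> pverts (ST3 n) \<and> v \<in> pverts (ST3 n)"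
proof -
  interpret pair_graph "ST3 n" by (rule pair_graph_ST3)
  show "(u, v) \<in> parcs (ST3 n) \<Longrightarrow> ?thesis" by (auto dest: in_arcsD1 in_arcsD2)
qed

lemma finite_pverts: "finite (pverts (ST3 n))"
proof -
  interpret pair_graph "ST3 n" by (rule pair_graph_ST3)
  show ?thesis by (rule pair_finite_verts)
qed

lemmas dst_sym = rdist_sym[OF sym_parcs]
lemmas sees_sym = clear_geodesic_sym[OF _ sym_parcs]

section \<open>Distances at the next level\<close>

lemma emb_relpow:
  "(u, v) \<in> parcs (ST3 n) ^^ k \<Longrightarrow> (emb n i u, emb n i v) \<in> parcs (ST3 (Suc n)) ^^ k"
proof (induction k arbitrary: v)
  case (Suc k)
  then obtain w where "(u, w) \<in> parcs (ST3 n) ^^ k" "(w, v) \<in> parcs (ST3 n)" by auto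
  then have "(emb n i u, emb n i w) \<in> parcs (ST3 (Suc n)) ^^ k"
    "(emb n i w, emb n i v) \<in> parcs (ST3 (Suc n))"
    using Suc.IH by (auto simp: parcs_Suc)
  then show ?case by auto
qed simp

lemma corner_exhaust3: "distinct [i, j, k] \<Longrightarrow> c = i \<or> c = j \<or> c = (k :: corner)"
  by (cases i; cases j; cases k; cases c) auto

text \<open>The metric facts at level \<open>n\<close> from which distances at level
  \<open>Suc n\<close> are computed; as a locale they form the induction hypothesis of the lemma
  \<open>ST3_metric\<close>.\<close>

locale ST3_metric =
  fixes n :: nat
  assumes reachable: "u \<in> pverts (ST3 n) \<Longrightarrow> v \<in> pverts (ST3 n) \<Longrightarrow> (u, v) \<in> (parcs (ST3 n))\<^sup>*"
    and dst_extreme_le: "u \<in> pverts (ST3 n) \<Longrightarrow> dst n u (extreme n c) \<le> 2 ^ n"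
    and dst_extreme_extreme: "a \<noteq> b \<Longrightarrow> dst n (extreme n a) (extreme n b) = 2 ^ n"
begin

lemma walk: "u \<in> pverts (ST3 n) \<Longrightarrow> v \<in> pverts (ST3 n) \<Longrightarrow> (u, v) \<in> parcs (ST3 n) ^^ dst n u v"
  by (intro rdist_walk reachable)

lemma dst_extreme_le': "u \<in> pverts (ST3 n) \<Longrightarrow> dst n (extreme n c) u \<le> 2 ^ n"
  using dst_extreme_le by (simp add: dst_sym)

lemma dst_eq_0_iff:
  "u \<in> pverts (ST3 n) \<Longrightarrow> v \<in> pverts (ST3 n) \<Longrightarrow> dst n u v = 0 \<longleftrightarrow> u = v"
  by (intro rdist_eq_0_iff reachable)

text \<open>
  Candidate for the distance from vertex \<open>u\<close> of copy \<open>i\<close> to vertex \<open>v\<close> of copy \<open>j\<close>, the other two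
  copies being \<open>a\<close> and \<open>b\<close>. It respects the gluing and drops by at most one along an edge, so it
  is a lower bound for the distance.
\<close>

definition potential :: "corner \<Rightarrow> corner \<Rightarrow> corner \<Rightarrow> corner list \<Rightarrow> corner \<Rightarrow> corner list \<Rightarrow> nat" where
  "potential j a b v i u =
    (if i = j then dst n u v
     else let k = (if i = a then b else a) in
       min (dst n u (extreme n j) + dst n (extreme n i) v)
           (dst n u (extreme n k) + 2 ^ n + dst n (extreme n k) v))"

text \<open>A shared vertex has one name in each of its two copies. If one of these is copy
  \<open>j\<close>, the long alternative contains two full sides and loses, as distances to corners
  are at most \<open>2 ^ n\<close>; otherwise the two terms of the minimum merely swap.\<close>

lemma potential_glue:
  assumes "distinct [j, a, b]" "v \<in> pverts (ST3 n)" "i \<noteq> m"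
  shows "potential j a b v i (extreme n m) = potential j a b v m (extreme n i)"
proof -
  have le: "dst n (extreme n c) v \<le> 2 ^ n" for c using assms(2) by (rule dst_extreme_le')
  show ?thesis
    using assms corner_exhaust3[OF assms(1), of i] corner_exhaust3[OF assms(1), of m]
      le[of a] le[of b] le[of j]
    by (auto simp: potential_def Let_def dst_extreme_extreme)
qed

text \<open>Induction along the walk: each distance in the formula drops by at most one per edge,
  and \<open>pot_eq\<close> covers the change of names at a shared vertex.\<close>

lemma potential_le_walk:
  assumes "distinct [j, a, b]" "v \<in> pverts (ST3 n)" "(x, emb n j v) \<in> parcs (ST3 (Suc n)) ^^ k"
    "x = emb n i u" "u \<in> pverts (ST3 n)"
  shows "potential j a b v i u \<le> k"
proof -
  have pot_eq: "potential j a b v i u = potential j a b v m w" if "emb n i u = emb n m w" for i u m w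
    using that potential_glue[OF assms(1,2), of i m] by (cases "i = m") (auto simp: emb_eq_iff)
  show ?thesis using assms(3-5)
  proof (induction k arbitrary: x i u)
    case 0
    then have "potential j a b v i u = potential j a b v j v" by (intro pot_eq) auto
    then show ?case by (simp add: potential_def)
  next
    case (Suc k)
    then obtain y where y: "(x, y) \<in> parcs (ST3 (Suc n))" "(y, emb n j v) \<in> parcs (ST3 (Suc n)) ^^ k"
      by (meson relpow_Suc_D2)
    then obtain m u' w where w: "(u', w) \<in> parcs (ST3 n)" "x = emb n m u'" "y = emb n m w"
      by (auto simp: parcs_Suc)
    have V: "u' \<in> pverts (ST3 n)" "w \<in> pverts (ST3 n)" using parcs_in_pverts[OF w(1)] by auto
    have "dst n u' z \<le> Suc (dst n w z)" if "z \<in> pverts (ST3 n)" for z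
      using w(1) V that by (intro rdist_step reachable)
    note this[OF assms(2)] this[OF extreme_in_ST3, of a] this[OF extreme_in_ST3, of b]
      this[OF extreme_in_ST3, of j]
    then have "potential j a b v m u' \<le> Suc (potential j a b v m w)"
      by (auto simp: potential_def Let_def)
    moreover have "potential j a b v m w \<le> k" using Suc.IH[OF y(2) w(3) V(2)] .
    moreover have "potential j a b v i u = potential j a b v m u'" using pot_eq[of i u m u'] w(2) Suc.prems(2) by simp
    ultimately show ?case by simp
  qed
qed

lemma emb_reachable:
  assumes "u \<in> pverts (ST3 n)" "v \<in> pverts (ST3 n)"
  shows "(emb n i u, emb n j v) \<in> (parcs (ST3 (Suc n)))\<^sup>*"
proof -
  have *: "(emb n i u, emb n i v) \<in> (parcs (ST3 (Suc n)))\<^sup>*"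
    if "u \<in> pverts (ST3 n)" "v \<in> pverts (ST3 n)" for u v i
    using emb_relpow[OF walk[OF that]] by (rule relpow_imp_rtrancl)
  from *[OF assms(1) extreme_in_ST3, of i j] *[OF extreme_in_ST3 assms(2), of j i]
  show ?thesis by (simp add: emb_extreme_commute[of n i j])
qed

lemma dst_Suc_triangle:
  "u \<in> pverts (ST3 n) \<Longrightarrow> v \<in> pverts (ST3 n) \<Longrightarrow> w \<in> pverts (ST3 n) \<Longrightarrow>
    dst (Suc n) (emb n i u) (emb n k w) \<le>
      dst (Suc n) (emb n i u) (emb n j v) + dst (Suc n) (emb n j v) (emb n k w)"
  by (intro rdist_triangle emb_reachable)

text \<open>Walks inside the copy give one inequality, the potential in its case
  \<open>i = j\<close> the other: no detour outside the copy is shorter.\<close>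

lemma dst_emb_same:
  assumes "u \<in> pverts (ST3 n)" "v \<in> pverts (ST3 n)"
  shows "dst (Suc n) (emb n i u) (emb n i v) = dst n u v"
proof (rule antisym)
  show "dst (Suc n) (emb n i u) (emb n i v) \<le> dst n u v"
    using emb_relpow[OF walk[OF assms]] by (rule rdist_le)
  obtain a b where "distinct [i, a, b]" by (cases i) (auto intro: that)
  from potential_le_walk[OF this assms(2) rdist_walk[OF emb_reachable[OF assms]] refl assms(1), of i]
  show "dst n u v \<le> dst (Suc n) (emb n i u) (emb n i v)"
    by (simp add: potential_def)
qed

text \<open>The upper bounds come from walks through the shared vertices, the lower bound from
  \<open>potential_le_walk\<close>. The summand \<open>2 ^ n\<close> is the side of copy
  \<open>k\<close> between its corners \<open>i\<close> and \<open>j\<close>.\<close>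

lemma dst_emb:
  assumes "distinct [i, j, k]" "u \<in> pverts (ST3 n)" "v \<in> pverts (ST3 n)"
  shows "dst (Suc n) (emb n i u) (emb n j v) =
    min (dst n u (extreme n j) + dst n (extreme n i) v)
        (dst n u (extreme n k) + 2 ^ n + dst n (extreme n k) v)"
proof (rule antisym)
  note ex = extreme_in_ST3
  have "dst (Suc n) (emb n i u) (emb n j v) \<le> dst n u (extreme n j) + dst n (extreme n i) v"
    using dst_Suc_triangle[OF assms(2) ex assms(3), of i j i j] assms(2,3)
    by (simp add: dst_emb_same ex emb_extreme_commute[of n i j])
       (simp add: dst_emb_same ex emb_extreme_commute[of n j i])
  moreover have "dst (Suc n) (emb n i u) (emb n j v) \<le>
      dst n u (extreme n k) + 2 ^ n + dst n (extreme n k) v"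
  proof -
    have 1: "dst (Suc n) (emb n i u) (emb n i (extreme n k)) = dst n u (extreme n k)"
      using assms by (simp add: dst_emb_same ex)
    have 2: "dst (Suc n) (emb n i (extreme n k)) (emb n k (extreme n j)) = 2 ^ n"
      unfolding emb_extreme_commute[of n i k] using assms
      by (simp add: dst_emb_same ex dst_extreme_extreme)
    have 3: "dst (Suc n) (emb n k (extreme n j)) (emb n j v) = dst n (extreme n k) v"
      unfolding emb_extreme_commute[of n k j] using assms by (simp add: dst_emb_same ex)
    show ?thesis
      using dst_Suc_triangle[OF assms(2) ex assms(3), of i j i k]
        dst_Suc_triangle[OF ex ex assms(3), of i k j k j] 1 2 3 by linarith
  qed
  ultimately show "dst (Suc n) (emb n i u) (emb n j v) \<le>
      min (dst n u (extreme n j) + dst n (extreme n i) v)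
        (dst n u (extreme n k) + 2 ^ n + dst n (extreme n k) v)" by simp
  have "distinct [j, i, k]" using assms(1) by auto
  from potential_le_walk[OF this assms(3) rdist_walk[OF emb_reachable[OF assms(2,3)]] refl assms(2), of i]
  show "min (dst n u (extreme n j) + dst n (extreme n i) v)
        (dst n u (extreme n k) + 2 ^ n + dst n (extreme n k) v) \<le>
      dst (Suc n) (emb n i u) (emb n j v)"
    using assms(1) by (simp add: potential_def)
qed

text \<open>The long route runs along a full side of copy \<open>k\<close> and then one of copy
  \<open>j\<close>, while the direct one costs at most \<open>2 ^ n + 2 ^ n\<close>.\<close>

lemma dst_emb_extreme:
  assumes "i \<noteq> j" "u \<in> pverts (ST3 n)"
  shows "dst (Suc n) (emb n i u) (extreme (Suc n) j) = dst n u (extreme n j) + 2 ^ n"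
proof -
  obtain k where k: "distinct [i, j, k]" using assms(1) by (cases i; cases j) (auto intro: that)
  have "dst n u (extreme n j) \<le> 2 ^ n" using assms(2) by (rule dst_extreme_le)
  then show ?thesis
    using k assms(1) dst_extreme_extreme[of k j] dst_extreme_extreme[of i j]
    by (auto simp add: extreme_Suc_emb dst_emb[OF k assms(2) extreme_in_ST3])
qed

end

lemma ST3_metric: "ST3_metric n"
proof (induction n)
  case 0
  have arc: "(u, v) \<in> parcs (ST3 0)" if "u \<in> pverts (ST3 0)" "v \<in> pverts (ST3 0)" "u \<noteq> v" for u v
    using that by (auto simp: ST3.simps)
  have d: "dst 0 u v \<le> 1" if "u \<in> pverts (ST3 0)" "v \<in> pverts (ST3 0)" for u v
  proof (cases "u = v")
    case False
    then show ?thesis using arc[OF that] by (intro rdist_le) auto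
  qed simp
  have r: "(u, v) \<in> (parcs (ST3 0))\<^sup>*" if "u \<in> pverts (ST3 0)" "v \<in> pverts (ST3 0)" for u v
    using arc[OF that] by (cases "u = v") auto
  show ?case
  proof
    fix a b :: corner assume "a \<noteq> b"
    have "dst 0 (extreme 0 a) (extreme 0 b) \<noteq> 0"
      using rdist_eq_0_iff[OF r[OF extreme_in_ST3 extreme_in_ST3]] \<open>a \<noteq> b\<close> by simp
    then show "dst 0 (extreme 0 a) (extreme 0 b) = 2 ^ 0"
      using d[OF extreme_in_ST3[of 0 a] extreme_in_ST3[of 0 b]] by simp
  qed (use d extreme_in_ST3[of 0] r in simp_all)
next
  case (Suc n)
  interpret ST3_metric n by (rule Suc)
  show ?case
  proof
    fix u v assume "u \<in> pverts (ST3 (Suc n))" "v \<in> pverts (ST3 (Suc n))"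
    then obtain i j u' v' where "u = emb n i u'" "u' \<in> pverts (ST3 n)"
      "v = emb n j v'" "v' \<in> pverts (ST3 n)"
      unfolding pverts_Suc by blast
    then show "(u, v) \<in> (parcs (ST3 (Suc n)))\<^sup>*"
      by (simp only: emb_reachable)
  next
    fix u c assume "u \<in> pverts (ST3 (Suc n))"
    then obtain i w where w: "u = emb n i w" "w \<in> pverts (ST3 n)" by (auto simp: pverts_Suc)
    show "dst (Suc n) u (extreme (Suc n) c) \<le> 2 ^ Suc n"
    proof (cases "i = c")
      case True
      then show ?thesis
        using w dst_extreme_le[OF w(2), of c] by (simp add: extreme_Suc_emb dst_emb_same extreme_in_ST3)
    next
      case False
      then show ?thesis
        using w dst_extreme_le[OF w(2), of c] by (simp add: dst_emb_extreme)
    qed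
  next
    fix a b :: corner assume "a \<noteq> b"
    then show "dst (Suc n) (extreme (Suc n) a) (extreme (Suc n) b) = 2 ^ Suc n"
      unfolding extreme_Suc_emb[of n a]
      by (simp add: dst_emb_extreme extreme_in_ST3 dst_extreme_extreme)
  qed
qed

interpretation ST3_metric n for n
  by (rule ST3_metric)

section \<open>Visibility within and between copies\<close>

text \<open>As a preimage, this puts a shared vertex of \<open>M\<close> into both copies that
  contain it.\<close>

abbreviation copy :: "nat \<Rightarrow> corner list set \<Rightarrow> corner \<Rightarrow> corner list set" where
  "copy n M i \<equiv> emb n i -` M"

text \<open>Passing to a copy loses nothing, because a geodesic between two of its vertices never
  leaves it.\<close>

lemma sees_emb_same:
  assumes "u \<in> pverts (ST3 n)" "v \<in> pverts (ST3 n)"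
  shows "sees (Suc n) M (emb n i u) (emb n i v) \<longleftrightarrow> sees n (copy n M i) u v"
proof
  assume "sees n (copy n M i) u v"
  then show "sees (Suc n) M (emb n i u) (emb n i v)"
  proof (induction rule: clear_geodesic.induct)
    case (step u w)
    have V: "u \<in> pverts (ST3 n)" "w \<in> pverts (ST3 n)" using parcs_in_pverts[OF step.hyps(1)] by auto
    show ?case
      using step assms V
      by (intro clear_geodesic.step[of "emb n i u" "emb n i w"]) (auto simp: parcs_Suc dst_emb_same)
  qed (rule clear_geodesic.endpoint)
next
  have "sees n (copy n M i) u v" if "sees (Suc n) M x (emb n i v)" "x = emb n i u" "u \<in> pverts (ST3 n)" for x u
    using that
  proof (induction arbitrary: u rule: clear_geodesic.induct)
    case endpoint
    then show ?case by (simp add: clear_geodesic.endpoint)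
  next
    case (step x y)
    then obtain m u' w where w: "(u', w) \<in> parcs (ST3 n)" "x = emb n m u'" "y = emb n m w"
      by (auto simp: parcs_Suc)
    have V: "u' \<in> pverts (ST3 n)" "w \<in> pverts (ST3 n)" using parcs_in_pverts[OF w(1)] by auto
    \<comment> \<open>An edge into another copy \<open>m\<close> would start at the shared vertex;
      from its other end \<open>w\<close> the target is no closer than from the shared vertex, so
      this is not a geodesic step.\<close>
    have m: "m = i"
    proof (rule ccontr)
      assume "m \<noteq> i"
      then obtain k where k: "distinct [m, i, k]" by (cases i; cases m) (auto intro: that)
      have "u = extreme n m" using \<open>m \<noteq> i\<close> w(2) step.prems(1) emb_eq_iff[of i m n] by auto
      then show False
        using step.hyps(2) w(3) step.prems(1) dst_emb[OF k V(2) assms(2)] dst_extreme_le'[OF assms(2), of m]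
          dst_emb_same[OF extreme_in_ST3 assms(2), of i m]
        by simp
    qed
    then have "u' = u" using w(2) step.prems(1) by simp
    then show ?case
      using step w m V assms
      by (intro clear_geodesic.step[of u w]) (auto simp: dst_emb_same)
  qed
  then show "sees (Suc n) M (emb n i u) (emb n i v) \<Longrightarrow> sees n (copy n M i) u v"
    using assms by blast
qed

text \<open>Conditions inside single copies for a clear geodesic through the vertex shared by
  \<open>i\<close> and \<open>j\<close>. The non-strict inequality lets a tie admit either route;
  the shared vertex may lie in \<open>M\<close> only if it is an end.\<close>

definition direct_route ::
  "nat \<Rightarrow> corner list set \<Rightarrow> corner \<Rightarrow> corner \<Rightarrow> corner \<Rightarrow> corner list \<Rightarrow> corner list \<Rightarrow> bool" where
  "direct_route n M i j k u v \<longleftrightarrow>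
    dst n u (extreme n j) + dst n (extreme n i) v \<le>
      dst n u (extreme n k) + 2 ^ n + dst n (extreme n k) v \<and>
    sees n (copy n M i) u (extreme n j) \<and> sees n (copy n M j) (extreme n i) v \<and>
    (emb n i (extreme n j) \<notin> M \<or> u = extreme n j \<or> v = extreme n i)"

text \<open>The counterpart along a side of copy \<open>k\<close>. Each of the two shared vertices
  can only coincide with the end in its own copy, hence one exception for each.\<close>

definition long_route ::
  "nat \<Rightarrow> corner list set \<Rightarrow> corner \<Rightarrow> corner \<Rightarrow> corner \<Rightarrow> corner list \<Rightarrow> corner list \<Rightarrow> bool" where
  "long_route n M i j k u v \<longleftrightarrow>
    dst n u (extreme n k) + 2 ^ n + dst n (extreme n k) v \<le>
      dst n u (extreme n j) + dst n (extreme n i) v \<and>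
    sees n (copy n M i) u (extreme n k) \<and> sees n (copy n M k) (extreme n i) (extreme n j) \<and>
    sees n (copy n M j) (extreme n k) v \<and>
    (emb n i (extreme n k) \<notin> M \<or> u = extreme n k) \<and>
    (emb n j (extreme n k) \<notin> M \<or> v = extreme n k)"

text \<open>Induction along the geodesic, generalised over the starting copy and split by the copy
  of the first edge. In copy \<open>i\<close> the edge prolongs the first leg; in copy
  \<open>j\<close> the start is the shared vertex and convexity finishes; in copy \<open>k\<close> a
  long route begins with an empty first leg.\<close>

lemma sees_embD:
  assumes "distinct [i, j, k]" "u \<in> pverts (ST3 n)" "v \<in> pverts (ST3 n)"
    "sees (Suc n) M (emb n i u) (emb n j v)"
  shows "direct_route n M i j k u v \<or> long_route n M i j k u v"
proof -
  note ex = extreme_in_ST3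
  have "direct_route n M i j k u v \<or> long_route n M i j k u v"
    if "sees (Suc n) M x (emb n j v)" "x = emb n i u" "u \<in> pverts (ST3 n)" "distinct [i, j, k]" for x i k u
    using that
  proof (induction arbitrary: i k u rule: clear_geodesic.induct)
    case endpoint
    then have "v = extreme n i" "u = extreme n j" using emb_eq_iff[of j i n v u] by auto
    then show ?case using endpoint.prems by (auto simp: direct_route_def intro: clear_geodesic.endpoint)
  next
    case (step x y)
    have V: "u \<in> pverts (ST3 n)" by (rule step.prems)
    have ijk: "i \<noteq> j" "j \<noteq> k" "i \<noteq> k" "distinct [i, j, k]" "distinct [k, j, i]"
      using step.prems(3) by auto
    obtain m u' w where w: "(u', w) \<in> parcs (ST3 n)" "x = emb n m u'" "y = emb n m w"
      using step.hyps(1) by (auto simp: parcs_Suc)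
    have W: "w \<in> pverts (ST3 n)" using parcs_in_pverts[OF w(1)] by auto
    have Y: "y \<notin> M \<or> y = emb n j v" by (rule step.hyps(3))
    have D: "dst (Suc n) (emb n i u) (emb n j v) = Suc (dst (Suc n) y (emb n j v))"
      using step.hyps(2) step.prems(1) by simp
    note Du = dst_emb[OF ijk(4) V assms(3)]
    have le: "dst n (extreme n c) v \<le> 2 ^ n" for c using assms(3) by (rule dst_extreme_le')
    consider "m = i" | "m = j" | "m = k" using corner_exhaust3[OF ijk(4)] by blast
    then show ?case
    proof cases
      case 1
      then have u: "u' = u" using w(2) step.prems(1) by simp
      have lip: "dst n u (extreme n c) \<le> Suc (dst n w (extreme n c))" for c
        using w(1) u W by (intro rdist_step reachable) (auto simp: ex)
      have y: "y = emb n j v \<Longrightarrow> w = extreme n j" using w(3) 1 ijk emb_eq_iff[of i j n w v] by auto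
      have yk: "y \<noteq> emb n j v \<or> w \<noteq> extreme n k" using y ijk by auto
      note Dw = dst_emb[OF ijk(4) W assms(3)]
      from step.IH[OF _ W ijk(4)] w(3) 1
      have "direct_route n M i j k w v \<or> long_route n M i j k w v" by simp
      then show ?thesis
      proof
        assume d: "direct_route n M i j k w v"
        then have "dst n u (extreme n j) = Suc (dst n w (extreme n j))"
          "dst n u (extreme n j) + dst n (extreme n i) v \<le>
            dst n u (extreme n k) + 2 ^ n + dst n (extreme n k) v"
          using D Du Dw w(3) 1 lip[of j] by (auto simp: direct_route_def)
        moreover from this have "sees n (copy n M i) u (extreme n j)"
          using w(1,3) u 1 Y y d by (intro clear_geodesic.step[of u w]) (auto simp: direct_route_def)
        moreover have "emb n i (extreme n j) \<notin> M \<or> u = extreme n j \<or> v = extreme n i"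
          using d Y w(3) 1 emb_eq_iff[OF ijk(1), of n w v] by (auto simp: direct_route_def)
        ultimately show ?thesis using d by (simp add: direct_route_def)
      next
        assume d: "long_route n M i j k w v"
        then have "dst n u (extreme n k) = Suc (dst n w (extreme n k))"
          "dst n u (extreme n k) + 2 ^ n + dst n (extreme n k) v \<le>
            dst n u (extreme n j) + dst n (extreme n i) v"
          using D Du Dw w(3) 1 lip[of k] by (auto simp: long_route_def)
        \<comment> \<open>From the vertex shared with copy \<open>j\<close> the long route would
          contain two full sides against a direct length of at most one. So \<open>y\<close> is not
          the target and avoids \<open>M\<close>.\<close>
        moreover have "w \<noteq> extreme n j"
        proof
          assume "w = extreme n j"
          with d have "2 ^ n + 2 ^ n \<le> dst n (extreme n i) v"
            using dst_extreme_extreme[OF ijk(2), of n] by (simp add: long_route_def)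
          moreover have "(0 :: nat) < 2 ^ n" by simp
          ultimately show False using le[of i] by linarith
        qed
        with y Y have "y \<notin> M" by auto
        moreover from calculation have "sees n (copy n M i) u (extreme n k)"
          using w(1,3) u 1 d by (intro clear_geodesic.step[of u w]) (auto simp: long_route_def)
        ultimately show ?thesis using d w(3) 1 by (auto simp: long_route_def)
      qed
    next
      case 2
      then have u: "u = extreme n j" "u' = extreme n i"
        using w(2) step.prems(1) emb_eq_iff[OF ijk(1), of n u u'] by auto
      have "sees (Suc n) M x (emb n j v)"
        using step.hyps by (rule clear_geodesic.step)
      then have "sees n (copy n M j) (extreme n i) v"
        using w(2) u 2 by (simp add: sees_emb_same ex assms(3))
      then show ?thesis
        using u le[of i] dst_extreme_extreme[OF ijk(2), of n]
        by (simp add: direct_route_def clear_geodesic.endpoint)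
    next
      case 3
      then have u: "u = extreme n k" "u' = extreme n i"
        using w(2) step.prems(1) emb_eq_iff[OF ijk(3), of n u u'] by auto
      have y: "y = emb n j v \<Longrightarrow> w = extreme n j \<and> v = extreme n k"
        using w(3) 3 ijk emb_eq_iff[of k j n w v] by auto
      note Dw = dst_emb[OF ijk(5) W assms(3)]
      have e: "dst n (extreme n i) (extreme n j) = 2 ^ n" "dst n (extreme n k) (extreme n j) = 2 ^ n"
        using ijk by (auto simp: dst_extreme_extreme)
      have lip: "dst n (extreme n i) (extreme n j) \<le> Suc (dst n w (extreme n j))"
        using w(1) u W by (intro rdist_step reachable) (auto simp: ex)
      from step.IH[OF _ W ijk(5)] w(3) 3
      have "direct_route n M k j i w v \<or> long_route n M k j i w v" by simp
      \<comment> \<open>The remaining route cannot go back through copy \<open>i\<close>: starting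
        from \<open>u\<close> along the side of copy \<open>i\<close> would then be shorter.\<close>
      then have d: "direct_route n M k j i w v"
        using D Du Dw w(3) 3 u e by (auto simp: long_route_def)
      then have dd: "dst n (extreme n i) (extreme n j) = Suc (dst n w (extreme n j))"
        "dst n (extreme n k) v \<le> dst n (extreme n i) v"
        using D Du Dw w(3) 3 u e lip by (auto simp: direct_route_def)
      then have "sees n (copy n M k) (extreme n i) (extreme n j)"
        using w(1,3) u 3 Y y d by (intro clear_geodesic.step[of "extreme n i" w]) (auto simp: direct_route_def)
      moreover have "emb n j (extreme n k) \<notin> M \<or> v = extreme n k"
        using d Y y w(3) 3 emb_extreme_commute[of n j k] by (auto simp: direct_route_def)
      ultimately show ?thesis
        using d dd u e by (auto simp: long_route_def direct_route_def clear_geodesic.endpoint)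
    qed
  qed
  then show ?thesis using assms by blast
qed

lemma sees_embI_direct:
  assumes ijk: "distinct [i, j, k]" and u: "u \<in> pverts (ST3 n)" and v: "v \<in> pverts (ST3 n)"
    and d: "direct_route n M i j k u v"
  shows "sees (Suc n) M (emb n i u) (emb n j v)"
proof -
  note ex = extreme_in_ST3
  have c: "emb n j (extreme n i) = emb n i (extreme n j)" by (rule emb_extreme_commute)
  have s1: "sees (Suc n) M (emb n i u) (emb n i (extreme n j))"
    using d u by (simp add: sees_emb_same ex direct_route_def)
  have "sees (Suc n) M (emb n j (extreme n i)) (emb n j v)"
    using d v by (simp add: sees_emb_same ex direct_route_def)
  then have s2: "sees (Suc n) M (emb n i (extreme n j)) (emb n j v)" by (simp add: c)
  have "dst (Suc n) (emb n j (extreme n i)) (emb n j v) = dst n (extreme n i) v"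
    using v by (simp add: dst_emb_same ex)
  then have d2: "dst (Suc n) (emb n i (extreme n j)) (emb n j v) = dst n (extreme n i) v"
    by (simp add: c)
  show ?thesis
  proof (rule clear_geodesic_append[OF s1 s2])
    show "emb n i (extreme n j) \<notin> M \<or> emb n i (extreme n j) = emb n i u \<or> emb n i (extreme n j) = emb n j v"
      using d c by (auto simp: direct_route_def)
    show "dst (Suc n) (emb n i u) (emb n j v) =
        dst (Suc n) (emb n i u) (emb n i (extreme n j)) + dst (Suc n) (emb n i (extreme n j)) (emb n j v)"
      using d by (simp add: d2 dst_emb[OF ijk u v] dst_emb_same u ex direct_route_def)
  qed
qed

lemma sees_embI_long:
  assumes ijk: "distinct [i, j, k]" and u: "u \<in> pverts (ST3 n)" and v: "v \<in> pverts (ST3 n)"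
    and d: "long_route n M i j k u v"
  shows "sees (Suc n) M (emb n i u) (emb n j v)"
proof -
  note ex = extreme_in_ST3
  let ?a = "emb n i (extreme n k)" and ?b = "emb n j (extreme n k)"
  have a: "emb n k (extreme n i) = ?a" and b: "emb n k (extreme n j) = ?b"
    by (rule emb_extreme_commute)+
  have s: "sees (Suc n) M (emb n i u) ?a" "sees (Suc n) M ?b (emb n j v)"
    using d u v by (simp_all add: sees_emb_same ex long_route_def)
  have s3: "sees (Suc n) M ?a ?b"
    unfolding a[symmetric] b[symmetric] using d by (simp add: sees_emb_same ex long_route_def)
  have D: "dst (Suc n) (emb n i u) ?a = dst n u (extreme n k)"
    "dst (Suc n) ?b (emb n j v) = dst n (extreme n k) v"
    "dst (Suc n) (emb n i u) (emb n j v) = dst n u (extreme n k) + 2 ^ n + dst n (extreme n k) v"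
    using d u v by (simp_all add: dst_emb_same ex dst_emb[OF ijk u v] long_route_def)
  have D3: "dst (Suc n) ?a ?b = 2 ^ n"
    unfolding a[symmetric] b[symmetric] using ijk by (simp add: dst_emb_same ex dst_extreme_extreme)
  \<comment> \<open>Two triangle inequalities pin this distance, so that both concatenations below
    add up to geodesics.\<close>
  have D4: "dst (Suc n) ?a (emb n j v) = 2 ^ n + dst n (extreme n k) v"
  proof -
    have "dst (Suc n) ?a (emb n j v) \<le> dst (Suc n) ?a ?b + dst (Suc n) ?b (emb n j v)"
      "dst (Suc n) (emb n i u) (emb n j v) \<le> dst (Suc n) (emb n i u) ?a + dst (Suc n) ?a (emb n j v)"
      by (rule dst_Suc_triangle; intro u v ex)+
    then show ?thesis using D D3 by simp
  qed
  have s4: "sees (Suc n) M ?a (emb n j v)"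
    using d D D3 D4 by (intro clear_geodesic_append[OF s3 s(2)]) (auto simp: long_route_def)
  show ?thesis
    using d D D4 by (intro clear_geodesic_append[OF s(1) s4]) (auto simp: long_route_def)
qed

section \<open>Upper bound\<close>

text \<open>For \<open>C = {}\<close> this is mutual visibility, as
  \<open>mutual_visibility_set_iff\<close> shows; the pairs \<open>u = v\<close> hold
  trivially.\<close>

definition seen_from :: "nat \<Rightarrow> corner list set \<Rightarrow> corner set \<Rightarrow> bool" where
  "seen_from n M C \<longleftrightarrow> M \<subseteq> pverts (ST3 n) \<and> (\<forall>u\<in>M. \<forall>v\<in>M. sees n M u v) \<and>
    (\<forall>c\<in>C. extreme n c \<notin> M \<and> (\<forall>u\<in>M. sees n M u (extreme n c)))"

definition cells :: "nat \<Rightarrow> nat" where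
  "cells n = (if n = 0 then 0 else 3 ^ (n - 1))"

text \<open>The first inequality allots \<open>cells n\<close> to each copy; the second leaves one
  extra vertex when only two copies use their share. At level 0, where a set avoiding all corners is
  empty, the value 0 fits both.\<close>

lemma cells_Suc: "3 * cells n \<le> cells (Suc n)" "2 * cells n + 1 \<le> cells (Suc n)"
  by (cases n; simp add: cells_def)+

definition bound_outer :: "nat \<Rightarrow> bool" where
  "bound_outer n \<longleftrightarrow> (\<forall>M C. seen_from n M C \<longrightarrow> card C \<le> 2 \<longrightarrow> card M + card C \<le> cells n + 3)"

definition bound_inner :: "nat \<Rightarrow> bool" where
  "bound_inner n \<longleftrightarrow> (\<forall>M i. seen_from n M UNIV \<longrightarrow>
    (\<forall>j. sees n M (extreme n i) (extreme n j)) \<longrightarrow> card M \<le> cells n)"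

definition bound_half :: "nat \<Rightarrow> bool" where
  "bound_half n \<longleftrightarrow> (\<forall>M i j. seen_from n M {j} \<longrightarrow>
    (\<forall>u\<in>M. dst n u (extreme n j) < dst n u (extreme n i)) \<longrightarrow> card M \<le> cells n)"

lemma obtain_third:
  assumes "i \<noteq> j"
  obtains k where "distinct [i, j, k :: corner]"
  using assms by (cases i; cases j) auto

text \<open>Towards the outer corner of copy \<open>j\<close> the long route contains two full sides
  and ties with the direct one only from \<open>u = extreme n k\<close>, which is excluded. The
  direct route crosses the shared vertex and follows a whole side of copy \<open>j\<close>.\<close>

lemma sees_cornerD:
  assumes "i \<noteq> j" "distinct [i, j, k]" "u \<in> pverts (ST3 n)" "u \<noteq> extreme n k"
    and "sees (Suc n) M (emb n i u) (extreme (Suc n) j)"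
  shows "sees n (copy n M i) u (extreme n j)" "sees n (copy n M j) (extreme n i) (extreme n j)"
    "emb n i (extreme n j) \<notin> M \<or> u = extreme n j"
proof -
  have "\<not> long_route n M i j k u (extreme n j)"
  proof
    assume "long_route n M i j k u (extreme n j)"
    then have "dst n u (extreme n k) = 0"
      using assms(1,2) dst_extreme_le[OF assms(3), of j] dst_extreme_extreme[of i j n]
        dst_extreme_extreme[of k j n]
      by (auto simp: long_route_def)
    then show False using assms(3,4) by (simp add: dst_eq_0_iff extreme_in_ST3)
  qed
  then have "direct_route n M i j k u (extreme n j)"
    using sees_embD[OF assms(2,3) extreme_in_ST3, of M j] assms(5) by (simp add: extreme_Suc_emb)
  then show "sees n (copy n M i) u (extreme n j)" "sees n (copy n M j) (extreme n i) (extreme n j)"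
    "emb n i (extreme n j) \<notin> M \<or> u = extreme n j"
    using assms(1) by (auto simp: direct_route_def)
qed

lemma pverts_0: "pverts (ST3 0) = range (extreme 0)"
  using corner_exhaust3[of Top corner.Left corner.Right] by (auto simp: image_iff ST3.simps extreme.simps)

lemma UNIV_corner: "(UNIV :: corner set) = {Top, corner.Left, corner.Right}"
  by (auto intro: corner.exhaust)

lemma card_UNIV_corner: "card (UNIV :: corner set) = 3"
  unfolding UNIV_corner by simp

section \<open>Induction step: parts and shared vertices\<close>

locale split =
  fixes n :: nat and M :: "corner list set" and C :: "corner set"
  assumes seen_from_M: "seen_from (Suc n) M C"
    and bounds: "bound_outer n" "bound_inner n" "bound_half n"
begin

text \<open>
  Parts leave out the glued vertices, which are counted separately, but may contain the corner of
  \<open>ST3 (Suc n)\<close> that belongs to the copy. Hence \<open>i\<close> counts as seen by part \<open>i\<close> only if \<open>i \<in> C\<close>,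
  which guarantees that this corner is not in \<open>M\<close>.
\<close>

definition part :: "corner \<Rightarrow> corner list set" where
  "part i = {u \<in> copy n M i. \<forall>j. j \<noteq> i \<longrightarrow> u \<noteq> extreme n j}"

definition glued :: "corner \<Rightarrow> corner \<Rightarrow> bool" where
  "glued i j \<longleftrightarrow> emb n i (extreme n j) \<in> M"

definition seen :: "corner \<Rightarrow> corner set" where
  "seen i = {c. (c \<noteq> i \<or> i \<in> C) \<and> (\<forall>u\<in>part i. sees n (part i) u (extreme n c))}"

lemma glued_commute: "glued i j \<longleftrightarrow> glued j i"
  by (simp add: glued_def emb_extreme_commute[of n i j])

lemma part_subset_copy: "part i \<subseteq> copy n M i"
  by (auto simp: part_def)

lemma partD:
  assumes "u \<in> part i"
  shows "u \<in> pverts (ST3 n)" "emb n i u \<in> M" "j \<noteq> i \<Longrightarrow> u \<noteq> extreme n j"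
proof -
  show M: "emb n i u \<in> M" "j \<noteq> i \<Longrightarrow> u \<noteq> extreme n j" using assms by (auto simp: part_def)
  then have "emb n i u \<in> pverts (ST3 (Suc n))" using seen_from_M by (auto simp: seen_from_def)
  then show "u \<in> pverts (ST3 n)" by (simp add: emb_in_pverts_iff)
qed

lemma sees_part: "sees n (copy n M i) u v \<Longrightarrow> sees n (part i) u v"
  by (rule clear_geodesic_antimono[OF _ part_subset_copy])

lemma M_sees: "x \<in> M \<Longrightarrow> y \<in> M \<Longrightarrow> sees (Suc n) M x y"
  using seen_from_M by (auto simp: seen_from_def)

lemma M_sees_corner: "c \<in> C \<Longrightarrow> x \<in> M \<Longrightarrow> sees (Suc n) M x (extreme (Suc n) c)"
  using seen_from_M by (auto simp: seen_from_def)

lemma part_sees: "u \<in> part i \<Longrightarrow> v \<in> part i \<Longrightarrow> sees n (part i) u v"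
  using M_sees[of "emb n i u" "emb n i v"] sees_emb_same[of u n v M i] sees_part partD(1,2) by blast

lemma seen_from_part: "D \<subseteq> seen i \<Longrightarrow> seen_from n (part i) D"
proof -
  assume D: "D \<subseteq> seen i"
  have "extreme n c \<notin> part i" if "c \<in> D" for c
  proof (cases "c = i")
    case True
    then have "extreme (Suc n) i \<notin> M" using that D seen_from_M by (auto simp: seen_from_def seen_def)
    then show ?thesis using True by (auto simp: part_def extreme_Suc_emb)
  next
    case False
    then show ?thesis by (auto simp: part_def)
  qed
  then show ?thesis
    using D by (auto simp: seen_from_def seen_def part_sees partD(1))
qed

lemma card_part_le:
  assumes "D \<subseteq> seen i" "card D \<le> 2"
  shows "card (part i) + card D \<le> cells n + 3"
  using bounds(1) seen_from_part[OF assms(1)] assms(2) by (auto simp: bound_outer_def)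

lemma card_part_half:
  assumes "j \<in> seen i" "\<And>u. u \<in> part i \<Longrightarrow> dst n u (extreme n j) < dst n u (extreme n k)"
  shows "card (part i) \<le> cells n"
  using bounds(3) seen_from_part[of "{j}" i] assms by (auto simp: bound_half_def)

text \<open>One estimate for two cases: the first bound with corners \<open>j\<close> and
  \<open>k\<close>, or, if \<open>i\<close> is in \<open>C\<close>, the second bound, which needs
  the two sides at corner \<open>i\<close> clear.\<close>

lemma card_part_inner:
  assumes "distinct [i, j, k]" "{j, k} \<subseteq> seen i"
    and "i \<in> C \<Longrightarrow> sees n (copy n M i) (extreme n j) (extreme n i)"
    and "i \<in> C \<Longrightarrow> sees n (copy n M i) (extreme n k) (extreme n i)"
    and i: "i \<in> C \<Longrightarrow> i \<in> seen i"
  shows "card (part i) + of_bool (i \<in> C) \<le> cells n + 1"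
proof (cases "i \<in> C")
  case True
  have "c \<in> seen i" for c using assms(2) i[OF True] corner_exhaust3[OF assms(1), of c] by auto
  then have "UNIV \<subseteq> seen i" by blast
  moreover have "sees n (part i) (extreme n i) (extreme n c)" for c
    using corner_exhaust3[OF assms(1), of c] sees_sym[OF sees_part[OF assms(3)[OF True]]]
      sees_sym[OF sees_part[OF assms(4)[OF True]]] clear_geodesic.endpoint by metis
  ultimately show ?thesis
    using bounds(2) seen_from_part[of UNIV i] True by (auto simp: bound_inner_def)
next
  case False
  then show ?thesis using card_part_le[OF assms(2)] assms(1) by auto
qed

text \<open>Every vertex of part \<open>i\<close> reaches the outer corner of copy \<open>j\<close>
  through the shared vertex and along a side of copy \<open>j\<close>, so a nonempty part
  \<open>i\<close> forces both to be clear.\<close>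

lemma part_corner:
  assumes "j \<in> C" "i \<noteq> j" "part i \<noteq> {}"
  shows "j \<in> seen i" "\<not> glued i j" "sees n (copy n M j) (extreme n i) (extreme n j)"
proof -
  obtain k where k: "distinct [i, j, k]" using assms(2) by (rule obtain_third)
  have *: "sees n (copy n M i) u (extreme n j) \<and> sees n (copy n M j) (extreme n i) (extreme n j) \<and>
      emb n i (extreme n j) \<notin> M" if "u \<in> part i" for u
    using sees_cornerD[OF assms(2) k partD(1)[OF that] partD(3)[OF that]
        M_sees_corner[OF assms(1) partD(2)[OF that]]] partD(3)[OF that, of j] k assms(2)
    by auto
  show "j \<in> seen i" using * sees_part assms(2) by (auto simp: seen_def)
  show "\<not> glued i j" "sees n (copy n M j) (extreme n i) (extreme n j)"
    using * assms(3) by (auto simp: glued_def)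
qed

lemma part_own_corner:
  assumes "i \<in> C"
  shows "i \<in> seen i"
proof -
  have "sees n (part i) u (extreme n i)" if "u \<in> part i" for u
    using M_sees_corner[OF assms partD(2)[OF that]] sees_part[of i "extreme n i" u] partD(1)[OF that]
    by (simp add: extreme_Suc_emb sees_emb_same extreme_in_ST3)
  then show ?thesis using assms by (simp add: seen_def)
qed

lemma part_corner_seen: "j \<in> C \<Longrightarrow> j \<in> seen i"
  using part_own_corner part_corner(1)[of j i] by (cases "i = j"; cases "part i = {}") (auto simp: seen_def)

lemma glued_seen:
  assumes "glued i j" "i \<noteq> j"
  shows "j \<in> seen i"
proof -
  have "sees n (part i) u (extreme n j)" if "u \<in> part i" for u
    using M_sees[OF partD(2)[OF that], of "emb n i (extreme n j)"] assms(1)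
      sees_part[of i "extreme n j" u] partD(1)[OF that]
    by (simp add: glued_def sees_emb_same extreme_in_ST3)
  then show ?thesis using assms by (simp add: seen_def)
qed

text \<open>In the long case the strict inequalities follow since the route contains a full side,
  neither end is a shared vertex, and distances to corners are at most \<open>2 ^ n\<close>. They
  feed the third bound.\<close>

lemma part_part:
  assumes "distinct [i, j, k]" "u \<in> part i" "v \<in> part j"
  obtains (direct) "\<not> glued i j" "sees n (part i) u (extreme n j)" "sees n (part j) v (extreme n i)"
  | (long) "\<not> glued i k" "\<not> glued j k" "sees n (part i) u (extreme n k)" "sees n (part j) v (extreme n k)"
      "dst n u (extreme n k) < dst n u (extreme n j)" "dst n v (extreme n k) < dst n v (extreme n i)"
proof -
  have ne: "u \<noteq> extreme n j" "u \<noteq> extreme n k" "v \<noteq> extreme n i" "v \<noteq> extreme n k"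
    using assms(1) partD(3)[OF assms(2), of j] partD(3)[OF assms(2), of k]
      partD(3)[OF assms(3), of i] partD(3)[OF assms(3), of k] by auto
  note V = partD(1)[OF assms(2)] partD(1)[OF assms(3)]
  have pos: "dst n u (extreme n k) \<noteq> 0" "dst n v (extreme n k) \<noteq> 0"
    using ne V by (simp_all add: dst_eq_0_iff extreme_in_ST3)
  have le: "dst n u (extreme n j) \<le> 2 ^ n" "dst n v (extreme n i) \<le> 2 ^ n"
    using V by (auto intro: dst_extreme_le)
  have "direct_route n M i j k u v \<or> long_route n M i j k u v"
    using sees_embD[OF assms(1) V] M_sees[OF partD(2)[OF assms(2)] partD(2)[OF assms(3)]] by blast
  then show ?thesis
  proof
    assume "direct_route n M i j k u v"
    then show ?thesis
      using ne by (intro direct) (auto simp: direct_route_def glued_def intro: sees_part sees_sym)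
  next
    assume "long_route n M i j k u v"
    then show ?thesis
      using ne pos le
      by (intro long) (auto simp: long_route_def glued_def dst_sym[of n v] intro: sees_part sees_sym)
  qed
qed

text \<open>Seen from copy \<open>i\<close>, the vertex shared by \<open>j\<close> and
  \<open>k\<close> is the far end of a side in both copies. A geodesic may enter through either, and
  the entrance it uses lies outside \<open>M\<close>.\<close>

lemma part_glued:
  assumes "distinct [i, j, k]" "u \<in> part i" "glued j k"
  shows "sees n (part i) u (extreme n j) \<and> \<not> glued i j \<or> sees n (part i) u (extreme n k) \<and> \<not> glued i k"
proof -
  have ne: "u \<noteq> extreme n j" "u \<noteq> extreme n k"
    using assms(1) partD(3)[OF assms(2), of j] partD(3)[OF assms(2), of k] by auto
  have "direct_route n M i j k u (extreme n k) \<or> long_route n M i j k u (extreme n k)"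
    using sees_embD[OF assms(1) partD(1)[OF assms(2)] extreme_in_ST3]
      M_sees[OF partD(2)[OF assms(2)]] assms(3) by (auto simp: glued_def)
  then show ?thesis
    using ne assms(1) by (auto simp: direct_route_def long_route_def glued_def intro: sees_part)
qed

lemma glued_corner:
  assumes "glued i j" "j \<in> C"
  shows "sees n (copy n M j) (extreme n i) (extreme n j)"
  using M_sees_corner[OF assms(2), of "emb n j (extreme n i)"] assms(1)
  by (simp add: glued_def emb_extreme_commute[of n i j] extreme_Suc_emb sees_emb_same extreme_in_ST3)

text \<open>A geodesic from the vertex shared by \<open>i\<close> and \<open>j\<close> to the outer
  corner of copy \<open>k\<close> enters \<open>k\<close> from copy \<open>i\<close> or from copy
  \<open>j\<close> and then follows a whole side of \<open>k\<close>.\<close>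

lemma glued_third_corner:
  assumes "distinct [i, j, k]" "glued i j" "k \<in> C"
  shows "sees n (copy n M k) (extreme n i) (extreme n k) \<and> \<not> glued i k \<or>
    sees n (copy n M k) (extreme n j) (extreme n k) \<and> \<not> glued j k"
proof -
  have "sees (Suc n) M (emb n i (extreme n j)) (emb n k (extreme n k))"
    using M_sees_corner[OF assms(3)] assms(2) by (simp add: glued_def extreme_Suc_emb)
  moreover have "distinct [i, k, j]" using assms(1) by auto
  ultimately have "direct_route n M i k j (extreme n j) (extreme n k) \<or>
      long_route n M i k j (extreme n j) (extreme n k)"
    using sees_embD extreme_in_ST3 by blast
  then show ?thesis
    using assms(1) by (auto simp: direct_route_def long_route_def glued_def emb_extreme_commute[of n j k])
qed

section \<open>Counting, and the first bound by the number of shared vertices in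
  \<open>M\<close>\<close>

lemma finite_part [simp]: "finite (part i)"
  by (rule finite_subset[OF subsetI[OF partD(1)] finite_pverts])

lemma card_M:
  assumes "distinct [i, j, k]"
  shows "card M = card (part i) + card (part j) + card (part k) +
    of_bool (glued i j) + of_bool (glued i k) + of_bool (glued j k)"
proof -
  let ?G = "M \<inter> {emb n i (extreme n j), emb n i (extreme n k), emb n j (extreme n k)}"
  note ne = assms[simplified]
  have M: "M = emb n i ` part i \<union> (emb n j ` part j \<union> (emb n k ` part k \<union> ?G))"
  proof (intro equalityI subsetI)
    fix x assume x: "x \<in> M"
    then obtain c u where u: "x = emb n c u" "u \<in> pverts (ST3 n)"
      using seen_from_M by (auto simp: seen_from_def pverts_Suc)
    show "x \<in> emb n i ` part i \<union> (emb n j ` part j \<union> (emb n k ` part k \<union> ?G))"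
    proof (cases "u \<in> part c")
      case True
      then show ?thesis using u corner_exhaust3[OF assms, of c] by auto
    next
      case False
      then obtain d where d: "d \<noteq> c" "u = extreme n d" using x u by (auto simp: part_def)
      then show ?thesis
        using x u corner_exhaust3[OF assms, of c] corner_exhaust3[OF assms, of d]
          emb_extreme_commute[of n c d] by auto
    qed
  qed (auto dest: partD(2))
  have disj: "emb n a ` part a \<inter> emb n b ` part b = {}" if "a \<noteq> b" for a b
    using that partD(3)[of _ a b] by (auto simp: emb_eq_iff)
  have disjG: "emb n a u \<noteq> emb n b (extreme n c)" if "u \<in> part a" "b \<noteq> c" for a b c u
    using that partD(3)[OF that(1)] emb_eq_iff[of a b n u] by (cases "a = b") auto
  have G: "emb n a ` part a \<inter> ?G = {}" for a using disjG ne by blast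
  have inj: "card (emb n a ` part a) = card (part a)" for a by (intro card_image) (simp add: inj_on_def)
  have "card ?G = of_bool (glued i j) + of_bool (glued i k) + of_bool (glued j k)"
    using ne by (auto simp: glued_def Int_insert_right emb_eq_iff)
  moreover have "card M = card (part i) + (card (part j) + (card (part k) + card ?G))"
    apply (subst M)
    apply (subst card_Un_disjoint, simp, simp, use disj G ne in blast)+
    apply (simp only: inj)
    done
  ultimately show ?thesis by simp
qed

text \<open>Some \<open>v\<close> in part \<open>j\<close> does not see corner \<open>i\<close>, so
  all of part \<open>i\<close> takes the long route to \<open>v\<close> and falls under the third
  bound. From part \<open>k\<close> no long route is possible: one to \<open>v\<close> would need
  \<open>v\<close> to see corner \<open>i\<close>, one to part \<open>i\<close> the opposite
  distance inequality.\<close>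

lemma unseen_part:
  assumes "distinct [i, j, k]" "\<not> glued i j" "part i \<noteq> {}" "i \<notin> seen j"
  shows "card (part i) \<le> cells n" "i \<notin> C" "{i, j} \<subseteq> seen k"
proof -
  obtain v where v: "v \<in> part j" "\<not> sees n (part j) v (extreme n i)"
    using assms(1,4) by (auto simp: seen_def)
  have far: "sees n (part i) u (extreme n k) \<and> dst n u (extreme n k) < dst n u (extreme n j)"
    if "u \<in> part i" for u
    using part_part[OF assms(1) that v(1)] v(2) by blast
  then have "k \<in> seen i" using assms(1) by (auto simp: seen_def)
  then show "card (part i) \<le> cells n" by (rule card_part_half[where k = j]) (use far in simp)
  show "i \<notin> C" using part_corner_seen assms(4) by blast
  have d: "distinct [k, j, i]" "distinct [k, i, j]" using assms(1) by auto
  have "sees n (part k) w (extreme n j)" if "w \<in> part k" for w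
    using part_part[OF d(1) that v(1)] v(2) by blast
  moreover have "sees n (part k) w (extreme n i)" if "w \<in> part k" for w
  proof -
    obtain u where u: "u \<in> part i" using assms(3) by blast
    from part_part[OF d(2) that u] far[OF u] show ?thesis by (metis less_asym)
  qed
  ultimately show "{i, j} \<subseteq> seen k" using assms(1) by (auto simp: seen_def)
qed

text \<open>If \<open>i\<close> is in \<open>C\<close>, both nonempty neighbouring parts look at its
  corner through copy \<open>i\<close>; this clears the two sides ending there, as the second bound
  requires.\<close>

lemma card_part_surrounded:
  assumes "distinct [i, j, k]" "{j, k} \<subseteq> seen i" "part j \<noteq> {}" "part k \<noteq> {}"
  shows "card (part i) + of_bool (i \<in> C) \<le> cells n + 1"
  using assms part_corner(3)[of i j] part_corner(3)[of i k] part_own_corner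
  by (intro card_part_inner) auto

lemma card_Int_corners:
  assumes "distinct [i, j, k]"
  shows "card (C \<inter> {i}) = of_bool (i \<in> C)"
    "card (C \<inter> {i, j}) = of_bool (i \<in> C) + of_bool (j \<in> C)"
    "card C = of_bool (i \<in> C) + of_bool (j \<in> C) + of_bool (k \<in> C)"
    "card (insert j (C \<inter> {i})) = Suc (of_bool (i \<in> C))"
    "card (insert k (C \<inter> {i, j})) = Suc (of_bool (i \<in> C) + of_bool (j \<in> C))"
proof -
  have C: "C = C \<inter> {i, j, k}" using corner_exhaust3[OF assms] by auto
  show "card C = of_bool (i \<in> C) + of_bool (j \<in> C) + of_bool (k \<in> C)"
    by (subst C) (use assms in \<open>auto simp: Int_insert_right\<close>)
qed (use assms in \<open>auto simp: Int_insert_right\<close>)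

text \<open>The cap at 2 reflects that the first bound is stated for at most two corners.\<close>

lemma card_part_unlimited:
  assumes "D \<subseteq> seen i"
  shows "card (part i) + min 2 (card D) \<le> cells n + 3"
proof -
  obtain D' where D': "D' \<subseteq> D" "card D' = min 2 (card D)"
    by (meson obtain_subset_with_card_n min.cobounded2)
  then show ?thesis using card_part_le[of D' i] assms by auto
qed

lemma corners_subset_seen: "C \<inter> D \<subseteq> seen i"
  using part_corner_seen by auto

text \<open>Either one of the other two parts is empty, or one falls under the third bound, or each
  sees the corner leading to the other and saves a vertex for it.\<close>

lemma card_unglued_one_empty:
  assumes "distinct [i, j, k]" "card C \<le> 2" "\<not> glued i j" "\<not> glued i k" "\<not> glued j k" "part k = {}"
  shows "card M + card C \<le> cells (Suc n) + 3"
proof -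
  have d: "distinct [j, i, k]" using assms(1) by auto
  note cM = card_M[OF assms(1)] and cC = card_Int_corners[OF assms(1)] card_Int_corners[OF d]
  have single: "card (part a) + card C \<le> cells n + 3" for a
    using card_part_le[of C a] part_corner_seen assms(2) by blast
  consider "part i = {}" | "part j = {}"
    | "part i \<noteq> {}" "i \<notin> seen j" | "part j \<noteq> {}" "j \<notin> seen i"
    | "i \<in> seen j" "j \<in> seen i" by blast
  then show ?thesis
  proof cases
    case 1
    then show ?thesis using cM assms(3-6) single[of j] cells_Suc(2)[of n] by simp
  next
    case 2
    then show ?thesis using cM assms(3-6) single[of i] cells_Suc(2)[of n] by simp
  next
    case 3
    then show ?thesis
      using cM assms(3-6) single[of j] unseen_part(1)[OF assms(1,3)] cells_Suc(2)[of n] by simp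
  next
    case 4
    then show ?thesis
      using cM assms(3-6) single[of i] unseen_part(1)[OF d] cells_Suc(2)[of n]
      by (simp add: glued_commute)
  next
    case 5
    have "card (part i) + min 2 (card (insert j (C \<inter> {i, k}))) \<le> cells n + 3"
      "card (part j) + min 2 (card (insert i (C \<inter> {j, k}))) \<le> cells n + 3"
      using 5 corners_subset_seen by (auto intro!: card_part_unlimited)
    moreover have "distinct [i, k, j]" "distinct [j, k, i]" using assms(1) by auto
    note card_Int_corners(5)[OF this(1)] card_Int_corners(5)[OF this(2)]
    ultimately show ?thesis
      using cM cC(3) assms(2-6) cells_Suc(2)[of n] by (auto simp: of_bool_def split: if_splits)
  qed
qed

text \<open>Part \<open>i\<close> falls under the third bound and part \<open>k\<close> sees both
  its inner corners. Either part \<open>j\<close> sees corner \<open>k\<close>, or part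
  \<open>k\<close> falls under the third bound too; each way the total is at most
  \<open>3 * cells n + 3\<close>.\<close>

lemma card_unglued_unseen:
  assumes "distinct [i, j, k]" "card C \<le> 2" "\<not> glued i j" "\<not> glued i k" "\<not> glued j k"
    "part i \<noteq> {}" "part j \<noteq> {}" "part k \<noteq> {}" "i \<notin> seen j"
  shows "card M + card C \<le> cells (Suc n) + 3"
proof -
  note cM = card_M[OF assms(1)]
  have d: "distinct [j, i, k]" "distinct [k, i, j]" "distinct [k, j, i]" using assms(1) by auto
  note i = unseen_part[OF assms(1,3,6,9)]
  show ?thesis
  proof (cases "k \<in> seen j")
    case True
    have "card (part k) + of_bool (k \<in> C) \<le> cells n + 1"
      using card_part_surrounded[OF d(2) i(3)] assms by simp
    moreover have "card (part j) + card (insert k (C \<inter> {j})) \<le> cells n + 3"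
      using True corners_subset_seen assms(1) by (intro card_part_le) (auto simp: Int_insert_right)
    moreover have "distinct [j, k, i]" using assms(1) by auto
    note card_Int_corners(4)[OF this]
    ultimately show ?thesis
      using cM card_Int_corners(3)[OF assms(1)] i assms(3-5) cells_Suc(1)[of n] by simp
  next
    case False
    have "\<not> glued k j" using assms(5) by (simp add: glued_commute)
    note k = unseen_part[OF d(3) this assms(8) False]
    have "card (part j) + card (C \<inter> {j}) \<le> cells n + 3"
      using corners_subset_seen by (intro card_part_le) (auto simp: Int_insert_right)
    then show ?thesis
      using cM card_Int_corners(3)[OF assms(1)] card_Int_corners(1)[OF d(1)] i k assms(3-5) cells_Suc(1)[of n]
      by simp
  qed
qed

lemma card_unglued:
  assumes "distinct [i, j, k]" "card C \<le> 2" "\<not> glued i j" "\<not> glued i k" "\<not> glued j k"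
  shows "card M + card C \<le> cells (Suc n) + 3"
proof (cases "part i = {} \<or> part j = {} \<or> part k = {}")
  case True
  have "distinct [j, k, i]" "distinct [i, k, j]" using assms(1) by auto
  then show ?thesis using True card_unglued_one_empty assms by (metis glued_commute)
next
  case ne: False
  have ng: "\<not> glued a b" if "a \<noteq> b" for a b
    using that assms(3-5) corner_exhaust3[OF assms(1), of a] corner_exhaust3[OF assms(1), of b]
    by (auto simp: glued_commute)
  have part: "part a \<noteq> {}" for a using ne corner_exhaust3[OF assms(1), of a] by auto
  show ?thesis
  proof (cases "\<exists>a b. a \<noteq> b \<and> a \<notin> seen b")
    case True
    then obtain a b where ab: "a \<noteq> b" "a \<notin> seen b" by blast
    obtain c where "distinct [a, b, c]" using ab(1) by (rule obtain_third)
    then show ?thesis using card_unglued_unseen[of a b c] ng part ab assms(2) by auto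
  next
    case False
    \<comment> \<open>All inner corners are seen, so summing over the three parts gives
      \<open>3 * cells n + 3\<close>.\<close>
    have *: "card (part a) + of_bool (a \<in> C) \<le> cells n + 1" if "distinct [a, b, c]" for a b c
    proof (rule card_part_surrounded[OF that])
      have "b \<noteq> a" "c \<noteq> a" using that by auto
      then show "{b, c} \<subseteq> seen a" using False by blast
    qed (rule part)+
    have "distinct [j, k, i]" "distinct [k, i, j]" using assms(1) by auto
    from *[OF assms(1)] *[OF this(1)] *[OF this(2)] show ?thesis
      using card_M[OF assms(1)] card_Int_corners(3)[OF assms(1)] assms(3-5) cells_Suc(1)[of n] by simp
  qed
qed

text \<open>A vertex of \<open>M\<close> shared with copy \<open>k\<close> blocks every long route
  through \<open>k\<close>, so only direct ones remain.\<close>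

lemma part_part_direct:
  assumes "distinct [i, j, k]" "glued i k \<or> glued j k" "part i \<noteq> {}" "part j \<noteq> {}"
  shows "j \<in> seen i" "i \<in> seen j" "\<not> glued i j"
proof -
  have *: "\<not> glued i j \<and> sees n (part i) u (extreme n j) \<and> sees n (part j) v (extreme n i)"
    if "u \<in> part i" "v \<in> part j" for u v
    using part_part[OF assms(1) that] assms(2) by blast
  then show "j \<in> seen i" "i \<in> seen j" "\<not> glued i j"
    using assms(1,3,4) by (fastforce simp: seen_def)+
qed

lemma card_glued_once_empty:
  assumes "distinct [i, j, k]" "card C \<le> 2" "glued i j" "\<not> glued i k" "\<not> glued j k" "part i = {}"
  shows "card M + card C \<le> cells (Suc n) + 3"
proof -
  have d: "distinct [j, i, k]" "distinct [k, j, i]" "distinct [j, k, i]" using assms(1) by auto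
  note cM = card_M[OF assms(1)] and cC = card_Int_corners(3)[OF assms(1)]
  consider "part j = {}" | "part j \<noteq> {}" "part k = {}" | "part j \<noteq> {}" "part k \<noteq> {}" by blast
  then show ?thesis
  proof cases
    case 1
    have "card (part k) + card C \<le> cells n + 3"
      using part_corner_seen assms(2) by (intro card_part_le) auto
    then show ?thesis using 1 cM assms(3-6) cells_Suc(2)[of n] by simp
  next
    case 2
    \<comment> \<open>Part \<open>j\<close> would have to look at the outer corner of copy
      \<open>i\<close> through a shared vertex in \<open>M\<close>.\<close>
    have "i \<notin> C" using part_corner(2)[of i j] 2 assms(1,3) by (auto simp: glued_commute)
    moreover have "card (part j) + min 2 (card (insert i (C \<inter> {j, k}))) \<le> cells n + 3"
      using glued_seen[of j i] assms(1,3) corners_subset_seen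
      by (intro card_part_unlimited) (auto simp: glued_commute)
    ultimately show ?thesis
      using 2 cM cC card_Int_corners(5)[OF d(3)] assms(2-6) cells_Suc(2)[of n]
      by (auto simp: of_bool_def split: if_splits)
  next
    case 3
    have "i \<notin> C" using part_corner(2)[of i j] 3 assms(1,3) by (auto simp: glued_commute)
    moreover have jk: "k \<in> seen j" "j \<in> seen k"
      using part_part_direct[OF d(3)] 3 assms(3) by (auto simp: glued_commute)
    moreover have "card (part j) + of_bool (j \<in> C) \<le> cells n + 1"
      using jk(1) glued_seen[of j i] assms(1,3) 3 part_corner(3)[of j k] part_own_corner
        glued_corner[of i j]
      by (intro card_part_inner[OF d(1)]) (auto simp: glued_commute)
    moreover have "card (part k) + card (insert j (C \<inter> {k})) \<le> cells n + 3"
      using jk(2) corners_subset_seen assms(1) by (intro card_part_le) (auto simp: Int_insert_right)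
    ultimately show ?thesis
      using 3 cM cC card_Int_corners(4)[OF d(2)] assms(3-6) cells_Suc(2)[of n] by simp
  qed
qed

lemma card_glued_once:
  assumes "distinct [i, j, k]" "card C \<le> 2" "glued i j" "\<not> glued i k" "\<not> glued j k"
  shows "card M + card C \<le> cells (Suc n) + 3"
proof -
  have d: "distinct [j, i, k]" "distinct [i, k, j]" "distinct [j, k, i]" "distinct [k, i, j]"
    using assms(1) by auto
  consider "part i = {}" | "part j = {}" | "part i \<noteq> {}" "part j \<noteq> {}" by blast
  then show ?thesis
  proof cases
    case 1
    then show ?thesis using card_glued_once_empty assms by blast
  next
    case 2
    then show ?thesis using card_glued_once_empty[OF d(1)] assms by (simp add: glued_commute)
  next
    case 3
    \<comment> \<open>The vertex shared by \<open>i\<close> and \<open>j\<close> blocks the direct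
      route, so both parts use the long one and fall under the third bound.\<close>
    have far: "sees n (part i) u (extreme n k) \<and> sees n (part j) v (extreme n k) \<and>
        dst n u (extreme n k) < dst n u (extreme n j) \<and> dst n v (extreme n k) < dst n v (extreme n i)"
      if "u \<in> part i" "v \<in> part j" for u v
      using part_part[OF assms(1) that] assms(3) by blast
    then have "k \<in> seen i" "k \<in> seen j" using 3 assms(1) by (fastforce simp: seen_def)+
    then have "card (part i) \<le> cells n" "card (part j) \<le> cells n"
      using far 3 by (metis card_part_half ex_in_conv)+
    moreover have "i \<notin> C" "j \<notin> C"
      using part_corner(2)[of i j] part_corner(2)[of j i] 3 assms(1,3) by (auto simp: glued_commute)
    moreover have "{i, j} \<subseteq> seen k"
      using part_part_direct(1)[of k i j] part_part_direct(1)[of k j i] 3 assms(1,3)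
      by (cases "part k = {}") (auto simp: glued_commute seen_def)
    then have "card (part k) + card {i, j} \<le> cells n + 3"
      using assms(1) by (intro card_part_le) auto
    ultimately show ?thesis
      using card_M[OF assms(1)] card_Int_corners(3)[OF assms(1)] assms(1,3-5) cells_Suc(1)[of n] by simp
  qed
qed

lemma card_glued_twice_one_empty:
  assumes "distinct [i, j, k]" "glued i j" "glued i k" "\<not> glued j k"
    "part i = {}" "part j \<noteq> {}" "part k = {}"
  shows "card M + card C \<le> cells (Suc n) + 3"
proof -
  have d: "distinct [j, i, k]" "distinct [i, k, j]" using assms(1) by auto
  have "i \<notin> C" using part_corner(2)[of i j] assms(1,2,6) by (auto simp: glued_commute)
  moreover have "k \<in> seen j"
    using part_glued[OF d(1)] assms(1,2,3) by (auto simp: seen_def glued_commute)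
  moreover have "i \<in> seen j" using glued_seen[of j i] assms(1,2) by (auto simp: glued_commute)
  \<comment> \<open>The vertex shared by \<open>i\<close> and \<open>k\<close> must see this corner,
    and its way through copy \<open>i\<close> is blocked by the vertex shared by \<open>i\<close>
    and \<open>j\<close>.\<close>
  moreover have "sees n (copy n M j) (extreme n k) (extreme n j)" if "j \<in> C"
    using glued_third_corner[OF d(2) assms(3) that] assms(2) by blast
  ultimately have "card (part j) + of_bool (j \<in> C) \<le> cells n + 1"
    using glued_corner[OF assms(2)] part_own_corner by (intro card_part_inner[OF d(1)]) auto
  then show ?thesis
    using \<open>i \<notin> C\<close> card_M[OF assms(1)] card_Int_corners(3)[OF assms(1)] assms(2-7) cells_Suc(2)[of n]
    by simp
qed

lemma card_glued_twice:
  assumes "distinct [i, j, k]" "card C \<le> 2" "glued i j" "glued i k" "\<not> glued j k"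
  shows "card M + card C \<le> cells (Suc n) + 3"
proof -
  have d: "distinct [j, i, k]" "distinct [i, k, j]" "distinct [j, k, i]" "distinct [k, i, j]"
    using assms(1) by auto
  note cM = card_M[OF assms(1)] and cC = card_Int_corners(3)[OF assms(1)]
  consider "part i \<noteq> {}" | "part i = {}" "part j \<noteq> {}" "part k = {}"
    | "part i = {}" "part j = {}" "part k \<noteq> {}" | "part i = {}" "part j \<noteq> {}" "part k \<noteq> {}"
    | "part i = {}" "part j = {}" "part k = {}" by blast
  then show ?thesis
  proof cases
    case 1
    \<comment> \<open>Both shared vertices of copy \<open>i\<close> are in \<open>M\<close>, so no
      route leads from part \<open>i\<close> to another part.\<close>
    have "part j = {}" using part_part_direct(3)[OF assms(1)] 1 assms(3,4) by blast
    moreover have "part k = {}" using part_part_direct(3)[OF d(2)] 1 assms(3,4) by blast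
    moreover have "j \<notin> C" "k \<notin> C" using part_corner(2)[of _ i] 1 assms(1,3,4) by auto
    moreover have "card (part i) + card {j, k} \<le> cells n + 3"
      using glued_seen assms(1,3,4) by (intro card_part_le) auto
    ultimately show ?thesis using cM cC assms(1,3-5) cells_Suc(2)[of n] by simp
  next
    case 2
    then show ?thesis using card_glued_twice_one_empty assms by blast
  next
    case 3
    then show ?thesis using card_glued_twice_one_empty[OF d(2)] assms by (simp add: glued_commute)
  next
    case 4
    have "i \<notin> C" using part_corner(2)[of i j] 4 assms(1,3) by (auto simp: glued_commute)
    moreover have jk: "k \<in> seen j" "j \<in> seen k"
      using part_part_direct[OF d(3)] 4 assms(3) by (auto simp: glued_commute)
    moreover have "card (part j) + of_bool (j \<in> C) \<le> cells n + 1"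
      using jk(1) glued_seen[of j i] assms(1,3) 4 part_corner(3)[of j k] part_own_corner
        glued_corner[of i j]
      by (intro card_part_inner[OF d(1)]) (auto simp: glued_commute)
    moreover have "card (part k) + of_bool (k \<in> C) \<le> cells n + 1"
      using jk(2) glued_seen[of k i] assms(1,4) 4 part_corner(3)[of k j] part_own_corner
        glued_corner[of i k]
      by (intro card_part_inner[OF d(4)]) (auto simp: glued_commute)
    ultimately show ?thesis using 4 cM cC assms(3-5) cells_Suc(2)[of n] by simp
  next
    case 5
    then show ?thesis using cM assms(2-5) cells_Suc(2)[of n] by simp
  qed
qed

text \<open>Three shared vertices in \<open>M\<close> block every route between copies: all parts
  and \<open>C\<close> are empty, leaving just these three vertices.\<close>

lemma card_glued_thrice:
  assumes "distinct [i, j, k]" "glued i j" "glued i k" "glued j k"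
  shows "card M + card C \<le> cells (Suc n) + 3"
proof -
  have gl: "glued a b" if "a \<noteq> b" for a b
    using that assms(2-4) corner_exhaust3[OF assms(1), of a] corner_exhaust3[OF assms(1), of b]
    by (auto simp: glued_commute)
  have "part a = {}" for a
  proof -
    obtain b c where abc: "distinct [a, b, c]" by (cases a) (auto intro: that)
    then show ?thesis using part_glued[OF abc] gl by fastforce
  qed
  moreover have "c \<notin> C" for c
  proof -
    obtain a b where abc: "distinct [a, b, c]" by (cases c) (auto intro: that)
    then show ?thesis using glued_third_corner[OF abc] gl by fastforce
  qed
  ultimately show ?thesis
    using card_M[OF assms(1)] card_Int_corners(3)[OF assms(1)] assms by simp
qed

lemma card_outer:
  assumes "card C \<le> 2"
  shows "card M + card C \<le> cells (Suc n) + 3"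
proof -
  have d: "distinct [Top, corner.Left, corner.Right]" "distinct [corner.Left, Top, corner.Right]"
    "distinct [corner.Right, Top, corner.Left]" "distinct [Top, corner.Right, corner.Left]"
    "distinct [corner.Left, corner.Right, Top]"
    by auto
  show ?thesis
    using card_unglued[OF d(1) assms] card_glued_thrice[OF d(1)]
      card_glued_once[OF d(1) assms] card_glued_once[OF d(4) assms] card_glued_once[OF d(5) assms]
      card_glued_twice[OF d(1) assms] card_glued_twice[OF d(2) assms] card_glued_twice[OF d(3) assms]
    unfolding glued_commute[of corner.Left Top] glued_commute[of corner.Right Top]
      glued_commute[of corner.Right corner.Left]
    by blast
qed

section \<open>The second and third bounds\<close>

lemma card_inner:
  assumes "C = UNIV" "\<And>j. sees (Suc n) M (extreme (Suc n) i) (extreme (Suc n) j)"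
  shows "card M \<le> cells (Suc n)"
proof -
  obtain j k where ijk: "distinct [i, j, k]" by (cases i) (auto intro: that)
  then have ne: "i \<noteq> j" "i \<noteq> k" "j \<noteq> k" and d: "distinct [i, k, j]" "distinct [j, i, k]"
      "distinct [k, i, j]" "distinct [j, k, i]" "distinct [k, j, i]" by auto
  \<comment> \<open>A clear side of the large triangle at corner \<open>i\<close> consists of a
    clear side of copy \<open>i\<close>, a clear side of copy \<open>b\<close> and a shared vertex
    outside \<open>M\<close>.\<close>
  have side: "sees n (copy n M i) (extreme n i) (extreme n b) \<and>
      sees n (copy n M b) (extreme n i) (extreme n b) \<and> \<not> glued i b" if "distinct [i, b, c]" for b c
    using sees_cornerD[OF _ that, where u = "extreme n i" and n = n and M = M] assms(2)[of b] that
    by (auto simp: extreme_Suc_emb glued_def extreme_in_ST3)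
  note s = side[OF ijk] side[OF d(1)]
  have seen: "c \<in> seen a" for a c using part_corner_seen assms(1) by blast
  have inner: "card (part a) \<le> cells n" if "distinct [a, b, c]"
    "sees n (copy n M a) (extreme n b) (extreme n a)" "sees n (copy n M a) (extreme n c) (extreme n a)"
    for a b c
    using card_part_inner[OF that(1)] seen that assms(1) by auto
  have i: "card (part i) \<le> cells n" using inner[OF ijk] s sees_sym by blast
  note cM = card_M[OF ijk]
  \<comment> \<open>The extra 1 is affordable when part \<open>j\<close> or part \<open>k\<close> is
    empty, by the second inequality of \<open>cells_Suc\<close>.\<close>
  have two: "card (part a) \<le> cells n + 1" for a
    using card_part_le[of "{i, j}" a] seen ne by auto
  consider "part j = {}" | "part k = {}" | "part j \<noteq> {}" "part k \<noteq> {}" by blast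
  then show ?thesis
  proof cases
    case 1
    show ?thesis
    proof (cases "part k = {}")
      case True
      then show ?thesis using 1 s cM i cells_Suc(2)[of n] by simp
    next
      case False
      then have "\<not> glued k j" using part_corner(2)[of j k] assms(1) ne by auto
      then show ?thesis using 1 s cM i two[of k] cells_Suc(2)[of n] by (simp add: glued_commute)
    qed
  next
    case 2
    have "part j \<noteq> {} \<Longrightarrow> \<not> glued j k" using part_corner(2)[of k j] assms(1) ne by auto
    then show ?thesis using 2 s cM i two[of j] cells_Suc(2)[of n] by (cases "part j = {}") auto
  next
    case 3
    have "card (part j) \<le> cells n"
      using inner[OF d(2)] s part_corner(3)[of j k] 3 ne assms(1) by auto
    moreover have "card (part k) \<le> cells n"
      using inner[OF d(3)] s part_corner(3)[of k j] 3 ne assms(1) by auto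
    moreover have "\<not> glued j k" using part_corner(2)[of k j] 3 ne assms(1) by auto
    ultimately show ?thesis using s cM i cells_Suc(1)[of n] by simp
  qed
qed

lemma card_half:
  assumes "C = {j}"
    and half: "\<And>x. x \<in> M \<Longrightarrow> dst (Suc n) x (extreme (Suc n) j) < dst (Suc n) x (extreme (Suc n) i)"
  shows "card M \<le> cells (Suc n)"
proof (cases "i = j")
  case True
  then have "M = {}" using half by auto
  then show ?thesis by simp
next
  case False
  then obtain k where ijk: "distinct [i, j, k]" by (rule obtain_third)
  then have d: "distinct [k, j, i]" "distinct [j, k, i]" by auto
  have V: "u \<in> pverts (ST3 n)" if "emb n a u \<in> M" for a u
    using that seen_from_M emb_in_pverts_iff by (auto simp: seen_from_def)
  \<comment> \<open>From copy \<open>i\<close>, the outer corner \<open>i\<close> is at distance at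
    most \<open>2 ^ n\<close> and the outer corner \<open>j\<close> at least that far.\<close>
  have i: "emb n i u \<notin> M" for u
  proof
    assume u: "emb n i u \<in> M"
    have "dst (Suc n) (emb n i u) (extreme (Suc n) i) = dst n u (extreme n i)"
      using V[OF u] by (simp add: extreme_Suc_emb dst_emb_same extreme_in_ST3)
    then show False
      using half[OF u] dst_extreme_le[OF V[OF u], of i] dst_emb_extreme[OF False V[OF u]] by simp
  qed
  have pi: "part i = {}" using i by (auto simp: part_def)
  have g: "\<not> glued i j" "\<not> glued i k" using i by (auto simp: glued_def)
  \<comment> \<open>From copy \<open>k\<close> both outer distances exceed the inner ones by
    \<open>2 ^ n\<close>, so the hypothesis descends to level \<open>n\<close>.\<close>
  have k: "dst n u (extreme n j) < dst n u (extreme n i)" if "u \<in> part k" for u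
    using half[OF partD(2)[OF that]] dst_emb_extreme[OF _ partD(1)[OF that], of k] ijk by auto
  have "card (part k) \<le> cells n"
    using k part_corner_seen[of j k] assms(1) by (intro card_part_half) auto
  note cM = card_M[OF ijk]
  show ?thesis
  proof (cases "part k = {}")
    case True
    have "card (part j) + of_bool (glued j k) \<le> cells (Suc n)"
    \<comment> \<open>The estimate \<open>cells n + 2\<close> of the second case fits into
      \<open>3 * cells n\<close> only if \<open>cells n\<close> is positive.\<close>
    proof (cases "n = 0")
      case True
      have "u = extreme n j" if u: "u \<in> part j" for u
      proof -
        obtain c where "u = extreme n c" using partD(1)[OF u] True pverts_0 by auto
        then show ?thesis using partD(3)[OF u, of c] by auto
      qed
      then have "part j \<subseteq> {extreme n j}" by blast
      moreover have "extreme n j \<notin> part j"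
        using seen_from_part[of "{j}" j] part_corner_seen[of j j] assms(1) by (auto simp: seen_from_def)
      ultimately have "part j = {}" by blast
      then show ?thesis using cells_Suc(2)[of n] by simp
    next
      case False
      then have "1 \<le> cells n" by (simp add: cells_def)
      moreover have "card (part j) + card {j} \<le> cells n + 3"
        using part_corner_seen assms(1) by (intro card_part_le) auto
      moreover have "card (part j) + card {j, k} \<le> cells n + 3" if "glued j k"
        using part_corner_seen[of j j] glued_seen[OF that] assms(1) ijk by (intro card_part_le) auto
      ultimately show ?thesis using cells_Suc(1)[of n] ijk by (cases "glued j k") auto
    qed
    then show ?thesis using True pi g cM by simp
  next
    case False
    then have g': "\<not> glued k j" using part_corner(2)[of j k] assms(1) ijk by auto
    obtain w where w: "w \<in> part k" using False by blast
    \<comment> \<open>A long route between copies \<open>k\<close> and \<open>j\<close> would run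
      through copy \<open>i\<close> and need \<open>w\<close> closer to \<open>i\<close> than to
      \<open>j\<close>.\<close>
    have "sees n (part j) v (extreme n k)" if "v \<in> part j" for v
      using part_part[OF d(1) w that] k[OF w] by (metis less_asym)
    then have "k \<in> seen j" using ijk by (auto simp: seen_def)
    then have "card (part j) + card {j, k} \<le> cells n + 3"
      using part_corner_seen[of j j] assms(1) ijk by (intro card_part_le) auto
    then show ?thesis
      using pi g g' cM ijk \<open>card (part k) \<le> cells n\<close> cells_Suc(2)[of n] by (auto simp: glued_commute)
  qed
qed

end

section \<open>The simultaneous induction\<close>

lemma card_bounds: "bound_outer n \<and> bound_inner n \<and> bound_half n"
proof (induction n)
  case 0
  have outer: "card M + card C \<le> 3" if "seen_from 0 M C" for M C
  proof -
    have "M \<subseteq> extreme 0 ` (- C)"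
      using that unfolding seen_from_def pverts_0 by blast
    then have "card M \<le> card (extreme 0 ` (- C))" 
      using finite_subset[OF subset_UNIV finite_UNIV_corner] by (intro card_mono finite_imageI)
    also have "\<dots> = card (- C)" by (intro card_image) (auto simp: inj_on_def)
    finally have "card M \<le> card (- C)" .
    moreover have "card (- C) = 3 - card C" "card C \<le> 3"
      using card_mono[OF finite_UNIV_corner subset_UNIV, of C] finite_subset[OF subset_UNIV finite_UNIV_corner]
      by (simp_all add: Compl_eq_Diff_UNIV card_Diff_subset card_UNIV_corner)
    ultimately show ?thesis by simp
  qed
  have inner: "M = {}" if "seen_from 0 M UNIV" for M
    using that by (auto simp: seen_from_def pverts_0)
  have half: "M = {}" if "seen_from 0 M {j}" "\<forall>u\<in>M. dst 0 u (extreme 0 j) < dst 0 u (extreme 0 i)" for M i j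
  proof -
    have "u \<notin> M" for u
    proof
      assume u: "u \<in> M"
      then have "dst 0 u (extreme 0 i) \<le> 1" "dst 0 u (extreme 0 j) = 0 \<longleftrightarrow> u = extreme 0 j"
        using that(1) dst_extreme_le[of u 0 i] dst_eq_0_iff[of u 0 "extreme 0 j"] extreme_in_ST3
        by (auto simp: seen_from_def)
      \<comment> \<open>A distance strictly below one is 0, so \<open>u\<close> would be corner
        \<open>j\<close>, which \<open>M\<close> excludes.\<close>
      then have "u = extreme 0 j" using that(2) u by fastforce
      then show False using that(1) u by (auto simp: seen_from_def)
    qed
    then show ?thesis by blast
  qed
  show ?case
    using outer by (auto simp: bound_outer_def bound_inner_def bound_half_def cells_def dest: inner half)
next
  case (Suc n)
  have split: "split n M C" if "seen_from (Suc n) M C" for M C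
    using that Suc by unfold_locales auto
  show ?case
    unfolding bound_outer_def bound_inner_def bound_half_def
  proof (intro conjI allI impI)
    show "card M + card C \<le> cells (Suc n) + 3" if "seen_from (Suc n) M C" "card C \<le> 2" for M C
      using split.card_outer[OF split] that .
    show "card M \<le> cells (Suc n)" if "seen_from (Suc n) M UNIV"
      "\<forall>j. sees (Suc n) M (extreme (Suc n) i) (extreme (Suc n) j)" for M i
      using split.card_inner[OF split[OF that(1)] refl] that(2) by blast
    show "card M \<le> cells (Suc n)" if "seen_from (Suc n) M {j}"
      "\<forall>u\<in>M. dst (Suc n) u (extreme (Suc n) j) < dst (Suc n) u (extreme (Suc n) i)" for M i j
      using split.card_half[OF split[OF that(1)] refl] that(2) by blast
  qed
qed

section \<open>Lower bound\<close>

lemma clear_geodesic_empty: "(u, v) \<in> R\<^sup>* \<Longrightarrow> clear_geodesic R {} v u"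
proof (induction "rdist R u v" arbitrary: u)
  case 0
  then show ?case by (simp add: rdist_eq_0_iff clear_geodesic.endpoint)
next
  case (Suc k)
  then have "(u, v) \<in> R ^^ Suc k" using rdist_walk by metis
  then obtain w where w: "(u, w) \<in> R" "(w, v) \<in> R ^^ k" by (meson relpow_Suc_D2)
  then have r: "(w, v) \<in> R\<^sup>*" by (metis relpow_imp_rtrancl)
  then have "rdist R w v = k"
    using rdist_step[OF w(1) r] rdist_le[OF w(2)] Suc.hyps(2) by simp
  then show ?case
    using Suc r w by (intro clear_geodesic.step[of u w]) auto
qed

lemma visible_iff_sees:
  assumes "u \<in> pverts (ST3 n)" "v \<in> pverts (ST3 n)"
  shows "visible (with_proj (ST3 n)) M u v \<longleftrightarrow> sees n M u v"
proof
  let ?G = "with_proj (ST3 n)"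
  interpret pair_graph "ST3 n" by (rule pair_graph_ST3)
  have wf: "pair_wf_digraph (ST3 n)" by unfold_locales
  have long: "Suc (dst n u v) \<le> length p" if "vwalk p ?G" "hd p = u" "last p = v" for p
  proof -
    have "p \<noteq> []" using that(1) by auto
    then show ?thesis using rdist_le[OF vwalk_relpow[OF that(1)]] that(2,3) by (cases p) auto
  qed
  {
    assume "visible ?G M u v"
    then obtain p where p: "vpath p ?G" "hd p = u" "last p = v" "set p \<inter> (M - {u, v}) = {}"
      and short: "\<And>q. vpath q ?G \<Longrightarrow> hd q = u \<Longrightarrow> last q = v \<Longrightarrow> vwalk_length p \<le> vwalk_length q"
      by (auto simp: visible_def shortest_vpath_def)
    have walk: "vwalk p ?G" using p(1) by auto
    \<comment> \<open>Without obstacles a path with \<open>dst n u v\<close> edges exists, so the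
      shortest path \<open>p\<close> has exactly this length.\<close>
    obtain q where q: "vpath q ?G" "hd q = u" "last q = v" "length q = Suc (dst n u v)"
      using clear_geodesic_imp_vpath[OF clear_geodesic_empty[OF reachable[OF assms]] assms(2) wf] by blast
    then have "length p = Suc (dst n u v)"
      using short[OF q(1-3)] long[OF walk p(2,3)] by simp
    moreover have "set (tl p) \<inter> (M - {last p}) = {}"
    proof -
      obtain q where "p = u # q" using walk p(2) by (cases p) auto
      moreover have "distinct p" using p(1) by auto
      ultimately show ?thesis using p(3,4) by auto
    qed
    ultimately show "sees n M u v"
      using vwalk_imp_clear_geodesic[OF walk] p(2,3) by simp
  next
    assume "sees n M u v"
    from clear_geodesic_imp_vpath[OF this assms(2) wf] obtain p where
      p: "vpath p ?G" "hd p = u" "last p = v" "length p = Suc (dst n u v)" "set (tl p) \<inter> (M - {v}) = {}"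
      by blast
    have "shortest_vpath ?G u p v"
      unfolding shortest_vpath_def
    proof (intro conjI allI impI)
      fix q assume "vpath q ?G \<and> hd q = u \<and> last q = v"
      then show "vwalk_length p \<le> vwalk_length q" using long[of q] p(4) by auto
    qed (use p in auto)
    moreover have "set p \<inter> (M - {u, v}) = {}"
      using p(2,5) by (cases p) auto
    ultimately show "visible ?G M u v" by (auto simp: visible_def)
  }
qed

lemma mutual_visibility_set_iff: "mutual_visibility_set (with_proj (ST3 n)) M \<longleftrightarrow> seen_from n M {}"
  unfolding mutual_visibility_set_def seen_from_def
  using visible_iff_sees[of _ n _ M] clear_geodesic.endpoint[of "parcs (ST3 n)" M]
  by (simp add: subset_iff) metis

section \<open>Assembling a set from three copies\<close>

lemma copy_Union:
  assumes "\<And>i c. c \<noteq> i \<Longrightarrow> extreme n c \<notin> N i"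
  shows "copy n (\<Union>i. emb n i ` N i) j = N j"
proof (intro equalityI subsetI)
  fix u assume "u \<in> copy n (\<Union>i. emb n i ` N i) j"
  then obtain i w where w: "emb n j u = emb n i w" "w \<in> N i" by auto
  then show "u \<in> N j"
    using assms[of j i] by (cases "i = j") (auto simp: emb_eq_iff)
qed auto

text \<open>Each \<open>N i\<close> avoids and sees the inner corners of its copy, so a direct route
  is clear whenever it is short enough; otherwise \<open>route\<close> supplies a clear side of the
  third copy.\<close>

lemma seen_from_Union:
  assumes N: "\<And>i. seen_from n (N i) (- {i})"
    and route: "\<And>i j k u v. distinct [i, j, k] \<Longrightarrow> u \<in> N i \<Longrightarrow> v \<in> N j \<Longrightarrow>
      sees n (N k) (extreme n i) (extreme n j) \<or>
      dst n u (extreme n j) + dst n (extreme n i) v \<le> dst n u (extreme n k) + 2 ^ n + dst n (extreme n k) v"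
  shows "seen_from (Suc n) (\<Union>i. emb n i ` N i) {}"
proof -
  let ?M = "\<Union>i. emb n i ` N i"
  have corner: "extreme n c \<notin> N i" if "c \<noteq> i" for i c using N that by (auto simp: seen_from_def)
  have copy [simp]: "copy n ?M j = N j" for j by (rule copy_Union) (rule corner)
  have V: "u \<in> pverts (ST3 n)" if "u \<in> N i" for u i
    using N[of i] that by (auto simp: seen_from_def)
  have "sees (Suc n) ?M (emb n i u) (emb n j v)" if uv: "u \<in> N i" "v \<in> N j" for i j u v
  proof (cases "i = j")
    case True
    then show ?thesis using uv V N by (auto simp: sees_emb_same seen_from_def)
  next
    case False
    then obtain k where ijk: "distinct [i, j, k]" by (rule obtain_third)
    have far: "sees n (N a) w (extreme n c)" "sees n (N a) (extreme n c) w" if "w \<in> N a" "c \<noteq> a" for a c w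
      using N that by (auto simp: seen_from_def intro: sees_sym)
    have free: "emb n a (extreme n c) \<notin> ?M" if "a \<noteq> c" for a c
      using corner[of c a] copy[of a] that by blast
    show ?thesis
    proof (cases "dst n u (extreme n j) + dst n (extreme n i) v \<le>
        dst n u (extreme n k) + 2 ^ n + dst n (extreme n k) v")
      case True
      then show ?thesis
        using uv V ijk far free by (intro sees_embI_direct[OF ijk]) (auto simp: direct_route_def)
    next
      case False
      then show ?thesis
        using uv V ijk far free route[OF ijk uv]
        by (intro sees_embI_long[OF ijk]) (auto simp: long_route_def)
    qed
  qed
  then show ?thesis using V emb_in_pverts by (auto simp: seen_from_def)
qed

lemma card_Union_emb:
  assumes "\<And>i c. extreme n c \<notin> J i" "\<And>i. finite (J i)" "\<And>i. card (J i) = m"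
  shows "card (\<Union>i. emb n i ` J i) = 3 * m"
proof -
  have "card (\<Union>i. emb n i ` J i) = (\<Sum>i\<in>UNIV. card (emb n i ` J i))"
    using assms(1,2) by (intro card_UN_disjoint) (auto simp: finite_UNIV_corner emb_eq_iff)
  also have "\<dots> = (\<Sum>i\<in>(UNIV :: corner set). m)"
    using assms(3) by (intro sum.cong refl) (simp add: card_image inj_on_def)
  also have "\<dots> = 3 * m" by (simp add: card_UNIV_corner)
  finally show ?thesis .
qed

lemma Union_emb_no_corner:
  assumes "\<And>i c. extreme n c \<notin> J i"
  shows "extreme (Suc n) c \<notin> (\<Union>i. emb n i ` J i)"
proof
  assume "extreme (Suc n) c \<in> (\<Union>i. emb n i ` J i)"
  then obtain i w where w: "emb n c (extreme n c) = emb n i w" "w \<in> J i" by (auto simp: extreme_Suc_emb)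
  then show False using assms[of c i] by (cases "c = i") (auto simp: emb_eq_iff)
qed

lemma Union_emb_corners:
  "(\<Union>i. emb n i ` insert (extreme n i) (J i)) = (\<Union>i. emb n i ` J i) \<union> range (extreme (Suc n))"
  by (auto simp: extreme_Suc_emb)

section \<open>Explicit sets at levels one and two\<close>

lemma sees_0: "u \<in> pverts (ST3 0) \<Longrightarrow> v \<in> pverts (ST3 0) \<Longrightarrow> sees 0 M u v"
  by (cases "u = v") (auto simp: ST3.simps intro: clear_geodesic.endpoint clear_geodesic_edge)

lemma dst_0: "dst 0 (extreme 0 a) (extreme 0 b) = of_bool (a \<noteq> b)"
  using dst_extreme_extreme[of a b 0] by (cases "a = b") auto

text \<open>The excluded pair consists of the two vertices shared with copy \<open>k\<close>; they
  are adjacent there, so the direct route is too long.\<close>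

lemma sees_1:
  assumes "distinct [i, j, k]" "emb 0 i (extreme 0 j) \<notin> M" "\<not> (a = k \<and> b = k)"
  shows "sees 1 M (emb 0 i (extreme 0 a)) (emb 0 j (extreme 0 b))"
proof -
  have "direct_route 0 M i j k (extreme 0 a) (extreme 0 b)"
    using assms by (auto simp: direct_route_def dst_0 sees_0 extreme_in_ST3)
  then show ?thesis using sees_embI_direct[OF assms(1) extreme_in_ST3 extreme_in_ST3] by simp
qed

lemma sees_1_same: "sees 1 M (emb 0 i (extreme 0 a)) (emb 0 i (extreme 0 b))"
  using sees_emb_same[OF extreme_in_ST3[of 0 a] extreme_in_ST3[of 0 b]] sees_0 extreme_in_ST3 by simp

text \<open>Level 1 has no vertex off the sides and gets its own set: two corners and two midpoints
  in the copies \<open>Top\<close> and \<open>corner.Left\<close>, leaving out the vertex shared by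
  these copies.\<close>

lemma mutual_1: "\<exists>M. seen_from 1 M {} \<and> card M = 4"
proof (intro exI conjI)
  define e where "e i a = emb 0 i (extreme 0 a)" for i a
  let ?M = "{e Top Top, e Top corner.Right, e corner.Left corner.Left, e corner.Left corner.Right}"
  have V: "e i a \<in> pverts (ST3 1)" for i a
    using emb_in_pverts[OF extreme_in_ST3[of 0 a]] by (simp add: e_def)
  have glue: "e i a = e a i" for i a by (simp add: e_def emb_extreme_commute)
  have eq: "e i a = e j b \<longleftrightarrow> i = j \<and> a = b \<or> i = b \<and> a = j" for i j a b
    by (cases "i = j") (auto simp: e_def emb_eq_iff)
  have same: "sees 1 M (e i a) (e i b)" for M i a b unfolding e_def by (rule sees_1_same)
  have free: "emb 0 Top (extreme 0 corner.Left) \<notin> ?M"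
    unfolding e_def[symmetric] by (simp add: eq)
  have other: "sees 1 ?M (e Top a) (e corner.Left b)" if "\<not> (a = corner.Right \<and> b = corner.Right)" for a b
    unfolding e_def[of Top a] e_def[of corner.Left b] using that free
    by (intro sees_1[of _ _ corner.Right]) auto
  have "sees 1 ?M (e Top a) (e corner.Left b)" for a b
  proof (cases "a = corner.Right \<and> b = corner.Right")
    case True
    \<comment> \<open>Both vertices also lie in copy \<open>corner.Right\<close>, where they are
      adjacent.\<close>
    have "sees 1 ?M (e corner.Right Top) (e corner.Right corner.Left)" by (rule same)
    then show ?thesis using True by (simp only: glue[of corner.Right])
  qed (rule other)
  moreover from this have "sees 1 ?M (e corner.Left b) (e Top a)" for a b by (rule sees_sym)
  ultimately show "seen_from 1 ?M {}"
    unfolding seen_from_def using V same by auto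
  show "card ?M = 4" by (simp add: eq)
qed

text \<open>The midpoint of the side opposite corner \<open>i\<close>; placed in copy
  \<open>i\<close> of the next level it lies on no side of \<open>ST3 2\<close>.\<close>

definition opposite_mid :: "corner \<Rightarrow> corner list" where
  "opposite_mid i = (case i of
      Top \<Rightarrow> emb 0 corner.Left (extreme 0 corner.Right)
    | corner.Left \<Rightarrow> emb 0 Top (extreme 0 corner.Right)
    | corner.Right \<Rightarrow> emb 0 Top (extreme 0 corner.Left))"

lemma opposite_mid: "distinct [i, j, k] \<Longrightarrow> opposite_mid i = emb 0 j (extreme 0 k)"
  using emb_extreme_commute[of 0]
  by (cases i; cases j; cases k) (simp_all add: opposite_mid_def)

lemma opposite_mid_2:
  "\<exists>J. seen_from 2 (J \<union> range (extreme 2)) {} \<and> range (extreme 2) \<inter> J = {} \<and> card J = 3"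
proof -
  let ?N = "\<lambda>i. {extreme 1 i, opposite_mid i}"
  have ex1: "extreme 1 i = emb 0 i (extreme 0 i)" for i by (simp add: extreme_Suc_emb)
  have eq: "emb 0 i (extreme 0 a) = emb 0 j (extreme 0 b) \<longleftrightarrow> i = j \<and> a = b \<or> i = b \<and> a = j" for i j a b
    by (cases "i = j") (auto simp: emb_eq_iff)
  have mid: "extreme 1 c \<noteq> opposite_mid i" for c i
  proof -
    obtain j k where d: "distinct [i, j, k]" by (cases i) (auto intro: that)
    then show ?thesis unfolding opposite_mid[OF d] ex1 eq by auto
  qed
  \<comment> \<open>Both elements of \<open>?N i\<close> are equidistant from the two inner corners
    of copy \<open>i\<close>, so the direct route is never longer than the long one.\<close>
  have d1: "dst 1 u (extreme 1 j) = dst 1 u (extreme 1 k)" if "distinct [i, j, k]" "u \<in> ?N i" for i j k u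
  proof -
    have d: "distinct [i, k, j]" using that(1) by auto
    have "dst 1 (opposite_mid i) (extreme 1 b) = 1" if "distinct [i, b, c]" for b c
      using that dst_emb_same[OF extreme_in_ST3[of 0 c] extreme_in_ST3[of 0 b], of b]
      unfolding opposite_mid[OF that] ex1 by (auto simp: dst_0)
    from this[OF that(1)] this[OF d] show ?thesis
      using that by (auto simp: dst_extreme_extreme)
  qed
  have "seen_from 1 (?N i) (- {i})" for i
  proof -
    obtain j k where d: "distinct [i, j, k]" by (cases i) (auto intro: that)
    then have d': "distinct [i, k, j]" by auto
    have V: "?N i \<subseteq> pverts (ST3 1)"
      using emb_in_pverts[OF extreme_in_ST3[of 0 k], of j] extreme_in_ST3[of 1 i]
      by (auto simp: opposite_mid[OF d])
    have *: "sees 1 (?N i) (extreme 1 i) (extreme 1 b)" "sees 1 (?N i) (opposite_mid i) (extreme 1 b)"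
      "sees 1 (?N i) (extreme 1 i) (opposite_mid i)" if d: "distinct [i, b, c]" for b c
    proof -
      have "emb 0 i (extreme 0 b) \<notin> ?N i" using d unfolding ex1 opposite_mid[OF d] by (auto simp: eq)
      then show "sees 1 (?N i) (extreme 1 i) (extreme 1 b)" "sees 1 (?N i) (extreme 1 i) (opposite_mid i)"
        unfolding ex1 opposite_mid[OF d] using sees_1[OF d] d by auto
      show "sees 1 (?N i) (opposite_mid i) (extreme 1 b)"
        using sees_sym[OF sees_1_same] unfolding ex1 opposite_mid[OF d] by blast
    qed
    have "sees 1 (?N i) u (extreme 1 c)" if "u \<in> ?N i" "c \<noteq> i" for u c
      using that *(1,2)[OF d] *(1,2)[OF d'] corner_exhaust3[OF d, of c] by auto
    moreover have "sees 1 (?N i) u v" if "u \<in> ?N i" "v \<in> ?N i" for u v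
      using that *(3)[OF d] sees_sym clear_geodesic.endpoint by auto
    moreover have "extreme 1 c \<notin> ?N i" if "c \<noteq> i" for c using that mid by auto
    ultimately show ?thesis using V by (auto simp: seen_from_def)
  qed
  then have "seen_from (Suc 1) (\<Union>i. emb 1 i ` ?N i) {}"
  proof (rule seen_from_Union)
    fix i j k u v assume ijk: "distinct [i, j, k]" and "u \<in> ?N i" "v \<in> ?N j"
    moreover have "distinct [j, i, k]" using ijk by auto
    then have "dst 1 v (extreme 1 i) = dst 1 v (extreme 1 k)" using \<open>v \<in> ?N j\<close> by (rule d1)
    then have "dst 1 (extreme 1 i) v = dst 1 (extreme 1 k) v" by (metis dst_sym)
    ultimately show "sees 1 (?N k) (extreme 1 i) (extreme 1 j) \<or> dst 1 u (extreme 1 j) + dst 1 (extreme 1 i) v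
        \<le> dst 1 u (extreme 1 k) + 2 ^ 1 + dst 1 (extreme 1 k) v"
      using d1[of i j k u] by simp
  qed
  moreover note Union_emb_corners[of 1 "\<lambda>i. {opposite_mid i}"]
    Union_emb_no_corner[of 1 "\<lambda>i. {opposite_mid i}"] card_Union_emb[of 1 "\<lambda>i. {opposite_mid i}" 1]
  ultimately show ?thesis
    using mid by (intro exI[of _ "\<Union>i. emb 1 i ` {opposite_mid i}"]) (auto simp: numeral_2_eq_2)
qed

text \<open>Carrying the corners along makes the induction work: \<open>J\<close> sees them, and
  they see one another, so sides are clear for long routes. Each copy keeps only its outer corner;
  dropping the inner ones just removes obstacles. Only \<open>J\<close> triples.\<close>

lemma mutual_with_corners:
  assumes "n \<ge> 2"
  shows "\<exists>J. seen_from n (J \<union> range (extreme n)) {} \<and> range (extreme n) \<inter> J = {} \<and> card J = 3 ^ (n - 1)"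
  using assms
proof (induction n rule: dec_induct)
  case base
  then show ?case using opposite_mid_2 by simp
next
  case (step n)
  then obtain J where J: "seen_from n (J \<union> range (extreme n)) {}" "range (extreme n) \<inter> J = {}"
    "card J = 3 ^ (n - 1)" by blast
  let ?J = "\<Union>i. emb n i ` J"
  have vis: "sees n (insert (extreme n i) J) u v"
    if "u \<in> J \<union> range (extreme n)" "v \<in> J \<union> range (extreme n)" for i u v
  proof -
    have "sees n (J \<union> range (extreme n)) u v" using J(1) that unfolding seen_from_def by blast
    then show ?thesis by (rule clear_geodesic_antimono) auto
  qed
  have "seen_from (Suc n) (\<Union>i. emb n i ` insert (extreme n i) J) {}"
  proof (rule seen_from_Union)
    show "seen_from n (insert (extreme n i) J) (- {i})" for i
      using J(1,2) vis by (auto simp: seen_from_def)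
  qed (use vis in auto)
  moreover have "card ?J = 3 * 3 ^ (n - 1)"
  proof (rule card_Union_emb)
    show "finite J" using J(1) finite_subset[OF _ finite_pverts[of n]] by (auto simp: seen_from_def)
  qed (use J in auto)
  moreover have "extreme (Suc n) c \<notin> ?J" for c using J(2) by (intro Union_emb_no_corner) auto
  ultimately show ?case
    using Union_emb_corners[of n "\<lambda>_. J"] step.hyps by (intro exI[of _ ?J]) (auto simp: power_eq_if)
qed

section \<open>The exact value\<close>

lemma mutual_visibility_attained:
  assumes "n \<ge> 1"
  shows "\<exists>M. seen_from n M {} \<and> card M = 3 ^ (n - 1) + 3"
proof (cases "n = 1")
  case True
  then show ?thesis using mutual_1 by simp
next
  case False
  then obtain J where J: "seen_from n (J \<union> range (extreme n)) {}" "range (extreme n) \<inter> J = {}"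
    "card J = 3 ^ (n - 1)" using mutual_with_corners[of n] assms by auto
  then have fin: "finite (J \<union> range (extreme n))"
    using finite_subset[OF _ finite_pverts[of n]] by (auto simp: seen_from_def)
  have "card (range (extreme n)) = 3"
    by (subst card_image) (auto simp: inj_on_def card_UNIV_corner)
  then have "card (J \<union> range (extreme n)) = 3 ^ (n - 1) + 3"
    using fin J by (subst card_Un_disjoint) auto
  then show ?thesis using J(1) by blast
qed

theorem theorem1:
  fixes n :: nat
  assumes "n \<ge> 1"
  shows "mutual_visibility_number (with_proj (ST3 n)) = 3 ^ (n - 1) + 3"
  unfolding mutual_visibility_number_def
proof (rule Max_eqI)
  interpret pair_graph "ST3 n" by (rule pair_graph_ST3)
  show "finite {card M |M. mutual_visibility_set (with_proj (ST3 n)) M}"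
    by (rule mutual_visibility_cards)
  show "m \<le> 3 ^ (n - 1) + 3" if "m \<in> {card M |M. mutual_visibility_set (with_proj (ST3 n)) M}" for m
    using that card_bounds[of n] assms
    by (force simp: mutual_visibility_set_iff bound_outer_def cells_def)
  show "3 ^ (n - 1) + 3 \<in> {card M |M. mutual_visibility_set (with_proj (ST3 n)) M}"
    using mutual_visibility_attained[OF assms] by (force simp: mutual_visibility_set_iff)
qed

end
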